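(* Let $b \geq 1$ be odd and let $n \equiv 3 \pmod 4$ with $n \geq 4b+11$. Put $t = \frac{n-4b-3}{4}$. Then $\Gamma(b,t,b,t)$ is a self-dual string C-group of rank $\frac{n-3}{2}$ isomorphic to $A_n$.
   Context: A rank $r$ sggi is a group $\langle \rho_0, \ldots, \rho_{r-1}\rangle$ with a distinguished ordered tuple of generators satisfying $\rho_i^2 = 1$ for all $i$ and $(\rho_i\rho_j)^2 = 1$ whenever $|i-j| \geq 2$. It is a string C-group if $\langle \rho_i \mid i \in I\rangle \cap \langle \rho_j \mid j \in J\rangle = \langle \rho_k \mid k \in I\cap J\rangle$ for all $I, J \subseteq \{0,\ldots,r-1\}$. It is self-dual if there is a group automorphism sending $\rho_i$ to $\rho_{r-1-i}$ for every $i$. For $b\geq 1$, $t \geq 2$, $\Gamma(b,t) = \langle \rho_0,\ldots,\rho_{b+t-1}\rangle$ is the rank $b+t$ sggi of permutations of $\{1,\ldots,2b+2t+2\}$ given, with $h_i = (2i+1,2i+3)(2i+2,2i+4)$, by $\rho_i = h_i$ for $i \neq b+1$ and $\rho_{b+1} = h_{b+1}\prod_{c=1}^{b+1}(2c-1,2c)$. The point $2b+2t+2$ is moved only by $\rho_{b+t-1}$. For $b_1,b_2\ge1$, $t_1,t_2\geq 2$, let $\Gamma(b_1,t_1)=\langle\rho_0,\ldots,\rho_{r_1-1}\rangle$ and $\Gamma(b_2,t_2)=\langle\sigma_0,\ldots,\sigma_{r_2-1}\rangle$ with $r_i=b_i+t_i$. The group $\Gamma(b_1,t_1,b_2,t_2)=\langle\phi_0,\ldots,\phi_{r_1+r_2-1}\rangle$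 (the gluing of $\Gamma(b_1,t_1)$ to the dual of $\Gamma(b_2,t_2)$) acts on the set of $2b_1+2t_1+2b_2+2t_2+3$ points obtained from the disjoint union of the two point sets by identifying the point $2b_1+2t_1+2$ of the first with the point $2b_2+2t_2+2$ of the second; for $0\leq i<r_1$, $\phi_i$ acts as $\rho_i$ on the first point set and fixes all other points, and for $r_1\leq i<r_1+r_2$, $\phi_i$ acts as $\sigma_{r_1+r_2-1-i}$ on the second point set and fixes all other points. *)

theory Defs
  imports "HOL-Algebra.Sym_Groups" "HOL-Algebra.Elementary_Groups"
begin

section \<open>String groups generated by involutions\<close>

text \<open>The distinguished tuple of generators is a list, whose length is the rank.\<close>

definition sggi :: "('a, 'm) monoid_scheme \<Rightarrow> 'a list \<Rightarrow> bool" where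
  "sggi G gs \<longleftrightarrow>
     group G \<and> set gs \<subseteq> carrier G \<and> generate G (set gs) = carrier G \<and>
     (\<forall>i < length gs. (gs ! i) [^]\<^bsub>G\<^esub> (2::nat) = \<one>\<^bsub>G\<^esub>) \<and>
     (\<forall>i < length gs. \<forall>j < length gs. \<bar>int i - int j\<bar> \<ge> 2 \<longrightarrow>
        (gs ! i \<otimes>\<^bsub>G\<^esub> gs ! j) [^]\<^bsub>G\<^esub> (2::nat) = \<one>\<^bsub>G\<^esub>)"

definition string_C_group :: "('a, 'm) monoid_scheme \<Rightarrow> 'a list \<Rightarrow> bool" where
  "string_C_group G gs \<longleftrightarrow>
     sggi G gs \<and>
     (\<forall>I J. I \<subseteq> {..<length gs} \<longrightarrow> J \<subseteq> {..<length gs} \<longrightarrow>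
        generate G ((!) gs ` I) \<inter> generate G ((!) gs ` J) = generate G ((!) gs ` (I \<inter> J)))"

definition self_dual :: "('a, 'm) monoid_scheme \<Rightarrow> 'a list \<Rightarrow> bool" where
  "self_dual G gs \<longleftrightarrow>
     (\<exists>f \<in> iso G G. \<forall>i < length gs. f (gs ! i) = gs ! (length gs - 1 - i))"

section \<open>The groups \<open>\<Gamma>(b,t)\<close> and their gluings\<close>

definition h_perm :: "nat \<Rightarrow> nat \<Rightarrow> nat" where
  "h_perm i = transpose (2*i + 1) (2*i + 3) \<circ> transpose (2*i + 2) (2*i + 4)"

definition pairs_perm :: "nat \<Rightarrow> nat \<Rightarrow> nat" where
  "pairs_perm m = foldr (\<lambda>c p. transpose (2*c - 1) (2*c) \<circ> p) [1..<Suc m] id"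

definition Gamma_gens :: "nat \<Rightarrow> nat \<Rightarrow> (nat \<Rightarrow> nat) list" where
  "Gamma_gens b t =
     map (\<lambda>i. if i = b + 1 then h_perm i \<circ> pairs_perm (b + 1) else h_perm i) [0..<b + t]"

definition Gamma_points :: "nat \<Rightarrow> nat \<Rightarrow> nat set" where
  "Gamma_points b t = {1..2*b + 2*t + 2}"

definition glue_degree :: "nat \<Rightarrow> nat \<Rightarrow> nat \<Rightarrow> nat \<Rightarrow> nat" where
  "glue_degree b1 t1 b2 t2 = 2*b1 + 2*t1 + 2*b2 + 2*t2 + 3"

text \<open>
  The glued point set is realised as \<open>{1..N}\<close> with \<open>N = glue_degree b1 t1 b2 t2\<close>.  The first
  point set keeps its labels, and the point \<open>x\<close> of the second one is given the label
  \<open>N + 1 - x\<close>.  Thus the second point set occupies \<open>{2*b1 + 2*t1 + 2..N}\<close>, and its point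
  \<open>2*b2 + 2*t2 + 2\<close> is identified with the point \<open>2*b1 + 2*t1 + 2\<close> of the first; no other
  points are identified.
  The function \<open>map_permutation A f p\<close> transports a permutation \<open>p\<close> of \<open>A\<close> along the
  injection \<open>f\<close> and is the identity outside \<open>f ` A\<close>.
\<close>

definition glue_label :: "nat \<Rightarrow> nat \<Rightarrow> nat \<Rightarrow> nat \<Rightarrow> nat \<Rightarrow> nat" where
  "glue_label b1 t1 b2 t2 x = glue_degree b1 t1 b2 t2 + 1 - x"

definition glue_gens :: "nat \<Rightarrow> nat \<Rightarrow> nat \<Rightarrow> nat \<Rightarrow> (nat \<Rightarrow> nat) list" where
  "glue_gens b1 t1 b2 t2 =
     (let r1 = b1 + t1; r2 = b2 + t2 in
      map (\<lambda>i. if i < r1 then Gamma_gens b1 t1 ! i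
               else map_permutation (Gamma_points b2 t2) (glue_label b1 t1 b2 t2)
                      (Gamma_gens b2 t2 ! (r1 + r2 - 1 - i)))
        [0..<r1 + r2])"

definition glue_group :: "nat \<Rightarrow> nat \<Rightarrow> nat \<Rightarrow> nat \<Rightarrow> (nat \<Rightarrow> nat) monoid" where
  "glue_group b1 t1 b2 t2 =
     subgroup_generated (sym_group (glue_degree b1 t1 b2 t2)) (set (glue_gens b1 t1 b2 t2))"

end

theory Submission
  imports Defs
begin

text \<open>
  Write \<open>r = b + t\<close>, so that there are \<open>2 * r\<close> generators \<open>\<phi>\<^sub>i\<close> and \<open>4 * r + 3\<close> points.  The points up to
  \<open>2 * r + 2\<close> form a ladder of \<open>r + 1\<close> columns with two rows.  The first \<open>r\<close> generators act on this
  ladder as signed permutations of the columns: \<open>\<phi>\<^sub>i\<close> swaps the columns \<open>i\<close> and \<open>i + 1\<close>, and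
  \<open>\<phi>\<^bsub>b+1\<^esub>\<close> moreover interchanges the two entries of each of the columns \<open>0, \<dots>, b\<close>.  The other
  generators act in the same way on a mirror image of the ladder, which shares only the central
  point \<open>2 * r + 2\<close>.  Reversing all points therefore reverses the tuple of generators; this is
  self-duality, and it halves the remaining work.

  The group is alternating for the following reason.  An element moving only points of the left
  ladder and an element moving only points of the right one have supports that meet at most in the
  central point, so if both move that point, then their commutator is a 3-cycle through it.  Hence
  any subgroup generated by a segment of generators on both sides of the centre contains all even
  permutations of the orbit of the central point (\<open>alternating_on_central_orbit\<close>).  For the full
  tuple this orbit contains every point, and all generators are even because \<open>b + 1\<close> is.

  For the intersection property it suffices to show that an initial and a final segment of
  generators intersect in the subgroup of the common segment (\<open>intersection_property\<close>).  If the
  common segment contains generators from both sides of the centre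
  (\<open>crossing_intersection\<close>), take a common element.  Outside the central orbit it
  agrees on the left ladder with a product of left generators and on the right ladder with a product
  of right ones, all from the common segment.  Dividing by these products leaves an even permutation
  of the central orbit, which lies in the subgroup by the preceding paragraph.  If one of the two
  segments stays on one side of the centre (\<open>one_sided_intersection\<close>, up to reversal),
  the common elements are signed column permutations.
  Their column permutation and flips are constrained by both segments, and an explicit
  description of the signed permutations generated by a segment shows that the constraints suffice.
\<close>

section \<open>Groups of words in involutions\<close>

text \<open>
  The generators considered are involutions, so that products of generators already form a group
  and no separate rule for inverses is needed.
\<close>

inductive_set words :: "('a \<Rightarrow> 'a) set \<Rightarrow> ('a \<Rightarrow> 'a) set" for S where
  words_id: "id \<in> words S"
| words_step: "s \<in> S \<Longrightarrow> p \<in> words S \<Longrightarrow> s \<circ> p \<in> words S"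

lemma words_incl: "s \<in> S \<Longrightarrow> s \<in> words S"
  using words_step[of s S id] words_id by fastforce

lemma words_comp:
  assumes "p \<in> words S" "q \<in> words S"
  shows "p \<circ> q \<in> words S"
  using assms
proof (induction rule: words.induct)
  case (words_step s p)
  then show ?case using words.words_step[of s S "p \<circ> q"] by (metis comp_assoc)
qed simp

lemma words_mono:
  assumes "S \<subseteq> T"
  shows "words S \<subseteq> words T"
proof
  fix p assume "p \<in> words S"
  then show "p \<in> words T"
    by induction (use assms words.intros in blast)+
qed

lemma words_inverse:
  assumes "\<And>s. s \<in> S \<Longrightarrow> s \<circ> s = id" "p \<in> words S"
  obtains q where "q \<in> words S" "q \<circ> p = id" "p \<circ> q = id"
proof -
  have "\<exists>q\<in>words S. q \<circ> p = id \<and> p \<circ> q = id"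
    using assms(2)
  proof induction
    case words_id
    then show ?case using words.words_id by (metis comp_id)
  next
    case (words_step s p)
    then obtain q where q: "q \<in> words S" "q \<circ> p = id" "p \<circ> q = id" by blast
    have s: "s \<circ> s = id" using assms(1) words_step by blast
    have "q \<circ> s \<in> words S" using q words_step by (simp add: words_comp words_incl)
    moreover have "(q \<circ> s) \<circ> (s \<circ> p) = id"
      using s q by (metis comp_assoc comp_id)
    moreover have "(s \<circ> p) \<circ> (q \<circ> s) = id"
      using s q by (metis comp_assoc comp_id)
    ultimately show ?case by blast
  qed
  then show thesis using that by blast
qed

lemma words_empty: "words {} = {id}"
  by (auto elim: words.cases intro: words.intros)

lemma words_commute:
  assumes "\<And>s t. s \<in> S \<Longrightarrow> t \<in> T \<Longrightarrow> s \<circ> t = t \<circ> s" "p \<in> words S" "q \<in> words T"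
  shows "p \<circ> q = q \<circ> p"
proof -
  have *: "s \<circ> q = q \<circ> s" if "s \<in> S" for s
    using assms(3)
  proof induction
    case (words_step t q)
    then show ?case using assms(1)[OF that, of t] by (metis comp_assoc)
  qed simp
  show ?thesis using assms(2)
  proof induction
    case (words_step s p)
    then show ?case using *[of s] by (metis comp_assoc)
  qed simp
qed

text \<open>
  Letters from two commuting sets can be sorted.  In a string group, leaving out one generator
  leaves two such sets.
\<close>

lemma words_Un_factor:
  assumes "\<And>s t. s \<in> S \<Longrightarrow> t \<in> T \<Longrightarrow> s \<circ> t = t \<circ> s" "g \<in> words (S \<union> T)"
  obtains p q where "p \<in> words S" "q \<in> words T" "g = p \<circ> q"
proof -
  have "\<exists>p\<in>words S. \<exists>q\<in>words T. g = p \<circ> q"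
    using assms(2)
  proof induction
    case words_id
    then show ?case using words.words_id by (metis comp_id)
  next
    case (words_step u g)
    then obtain p q where pq: "p \<in> words S" "q \<in> words T" "g = p \<circ> q" by blast
    show ?case
    proof (cases "u \<in> S")
      case True
      then show ?thesis using pq by (metis comp_assoc words.words_step)
    next
      case False
      then have u: "u \<in> T" using words_step by blast
      then have "p \<circ> u = u \<circ> p"
        using words_commute[of S T p u] assms(1) pq words_incl by blast
      then have "u \<circ> g = p \<circ> (u \<circ> q)" using pq by (metis comp_assoc)
      then show ?thesis using pq u by (metis words.words_step)
    qed
  qed
  then show thesis using that by blast
qed

section \<open>The intersection property from initial and final segments\<close>

lemma comp_cancel_left: "a \<circ> b = id \<Longrightarrow> a \<circ> (b \<circ> c) = c"
  by (simp add: fun_eq_iff)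

lemma comp_cancel_right: "b \<circ> a = id \<Longrightarrow> (c \<circ> b) \<circ> a = c"
  by (simp add: fun_eq_iff)

locale string_involutions =
  fixes \<phi> :: "nat \<Rightarrow> 'a \<Rightarrow> 'a" and R :: nat
  assumes invol: "i < R \<Longrightarrow> \<phi> i \<circ> \<phi> i = id"
    and commute: "i + 2 \<le> j \<Longrightarrow> j < R \<Longrightarrow> \<phi> i \<circ> \<phi> j = \<phi> j \<circ> \<phi> i"
begin

definition par :: "nat set \<Rightarrow> ('a \<Rightarrow> 'a) set" where
  "par I = words (\<phi> ` I)"

lemma par_mono: "I \<subseteq> J \<Longrightarrow> par I \<subseteq> par J"
  unfolding par_def by (intro words_mono image_mono)

lemma par_comp: "p \<in> par I \<Longrightarrow> q \<in> par I \<Longrightarrow> p \<circ> q \<in> par I"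
  unfolding par_def by (rule words_comp)

lemma par_gen: "i \<in> I \<Longrightarrow> \<phi> i \<in> par I"
  unfolding par_def by (intro words_incl imageI)

lemma par_id: "id \<in> par I"
  unfolding par_def by (rule words_id)

lemma par_inverse:
  assumes "I \<subseteq> {..<R}" "p \<in> par I"
  obtains q where "q \<in> par I" "q \<circ> p = id" "p \<circ> q = id"
proof -
  have "s \<circ> s = id" if "s \<in> \<phi> ` I" for s using that assms(1) invol by auto
  then show thesis using words_inverse[of "\<phi> ` I" p] assms(2) that unfolding par_def by blast
qed

lemma par_split:
  assumes "I \<subseteq> {..<R}" "k \<notin> I" "g \<in> par I"
  obtains p q where "p \<in> par (I \<inter> {..<k})" "q \<in> par (I \<inter> {k<..})" "g = p \<circ> q"
proof -
  have I: "I = (I \<inter> {..<k}) \<union> (I \<inter> {k<..})" using assms(2) linorder_neq_iff[of _ k] by auto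
  have g: "g \<in> words (\<phi> ` (I \<inter> {..<k}) \<union> \<phi> ` (I \<inter> {k<..}))"
    using assms(3) unfolding par_def by (metis I image_Un)
  have c: "s \<circ> t = t \<circ> s" if st: "s \<in> \<phi> ` (I \<inter> {..<k})" "t \<in> \<phi> ` (I \<inter> {k<..})" for s t
  proof -
    obtain i j where "s = \<phi> i" "t = \<phi> j" "i < k" "k < j" "j \<in> I" using st by auto
    then show ?thesis using commute[of i j] assms(1) by auto
  qed
  show thesis using words_Un_factor[OF c g] that unfolding par_def by blast
qed

text \<open>
  The proof is by induction on the length of an interval containing \<open>I\<close> and \<open>J\<close>.  If \<open>I\<close> omits \<open>k\<close>
  and \<open>J\<close> omits \<open>l \<ge> k\<close>, a common element \<open>g\<close> is \<open>g1 \<circ> g2\<close>, split at \<open>k\<close>, as well as \<open>h1 \<circ> h2\<close>, split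
  at \<open>l\<close>.  The discrepancy \<open>u\<close> between \<open>h1\<close> and \<open>g1\<close> is also the one between \<open>g2\<close> and \<open>h2\<close>, so it
  belongs to an initial and to a final segment, hence uses only generators strictly between
  \<open>k\<close> and \<open>l\<close>.  The induction hypothesis on both sides of \<open>k\<close> then puts \<open>g1\<close> and \<open>g2\<close> into
  the subgroup of \<open>I \<inter> J\<close>.
\<close>

theorem intersection_property:
  assumes segs: "\<And>s e. s \<le> R \<Longrightarrow> e \<le> R \<Longrightarrow> par {..<e} \<inter> par {s..<R} \<subseteq> par {s..<e}"
    and IJ: "I \<subseteq> {..<R}" "J \<subseteq> {..<R}"
  shows "par I \<inter> par J = par (I \<inter> J)"
proof
  show "par (I \<inter> J) \<subseteq> par I \<inter> par J" by (simp add: par_mono)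
  have intervals: "g \<in> par {s..<e}"
    if "g \<in> par X" "g \<in> par Y" "X \<subseteq> {..<e}" "Y \<subseteq> {s..<R}" "e \<le> R" for g X Y s e
  proof (cases "s \<le> R")
    case True
    then show ?thesis using that segs[of s e] par_mono[of X "{..<e}"] par_mono[of Y "{s..<R}"] by blast
  next
    case False
    then show ?thesis using that par_mono[of Y "{s..<e}"] by auto
  qed
  have "g \<in> par (I \<inter> J)"
    if "I \<subseteq> {s..<e}" "J \<subseteq> {s..<e}" "e \<le> R" "g \<in> par I" "g \<in> par J" for g I J s e
    using that
  proof (induction "e - s" arbitrary: g I J s e rule: less_induct)
    case less
    have core: "g \<in> par (I \<inter> J)"
      if I: "I \<subseteq> {s..<e}" and J: "J \<subseteq> {s..<e}" and gI: "g \<in> par I" and gJ: "g \<in> par J"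
        and k: "k \<in> {s..<e}" "k \<notin> I" and l: "l \<in> {s..<e}" "l \<notin> J" and kl: "k \<le> l" for I J k l
    proof -
      have IR: "I \<subseteq> {..<R}" "J \<subseteq> {..<R}" using I J less.prems by auto
      obtain g1 g2 where g: "g1 \<in> par (I \<inter> {..<k})" "g2 \<in> par (I \<inter> {k<..})" "g = g1 \<circ> g2"
        using par_split[OF IR(1) k(2) gI] .
      obtain h1 h2 where h: "h1 \<in> par (J \<inter> {..<l})" "h2 \<in> par (J \<inter> {l<..})" "g = h1 \<circ> h2"
        using par_split[OF IR(2) l(2) gJ] .
      obtain h1' where h1': "h1' \<in> par (J \<inter> {..<l})" "h1' \<circ> h1 = id" "h1 \<circ> h1' = id"
        using par_inverse[OF _ h(1)] IR(2) by blast
      obtain g2' where g2': "g2' \<in> par (I \<inter> {k<..})" "g2' \<circ> g2 = id" "g2 \<circ> g2' = id"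
        using par_inverse[OF _ g(2)] IR(1) by blast
      define u where "u = h1' \<circ> g1"
      have "(h1' \<circ> g1) \<circ> g2 = h1' \<circ> (h1 \<circ> h2)" using g(3) h(3) by (simp only: comp_assoc)
      then have "u \<circ> g2 = h2" by (simp only: u_def comp_cancel_left[OF h1'(2)])
      then have u_eq: "u = h2 \<circ> g2'" using comp_cancel_right[OF g2'(3), of u] by simp
      have "u \<in> par (({..<k} \<inter> I) \<union> ({..<l} \<inter> J))" unfolding u_def
        using par_comp par_mono[of "J \<inter> {..<l}" "({..<k} \<inter> I) \<union> ({..<l} \<inter> J)"]
          par_mono[of "I \<inter> {..<k}" "({..<k} \<inter> I) \<union> ({..<l} \<inter> J)"] h1'(1) g(1) by blast
      moreover have "u \<in> par ({k<..} \<inter> I \<union> {l<..} \<inter> J)" unfolding u_eq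
        using par_comp par_mono[of "J \<inter> {l<..}" "{k<..} \<inter> I \<union> {l<..} \<inter> J"]
          par_mono[of "I \<inter> {k<..}" "{k<..} \<inter> I \<union> {l<..} \<inter> J"] h(2) g2'(1) by blast
      ultimately have u: "u \<in> par {Suc k..<l}"
        by (rule intervals) (use IR kl l less.prems in auto)
      have lR: "l \<le> R" using l less.prems(3) by simp
      have ik: "{Suc k..<l} \<subseteq> {..<R}" using lR by auto
      obtain u' where u': "u' \<in> par {Suc k..<l}" "u' \<circ> u = id" "u \<circ> u' = id"
        using par_inverse[OF ik u] .
      have g1: "g1 = h1 \<circ> u" by (simp only: u_def comp_cancel_left[OF h1'(3)])
      then have "h1 = g1 \<circ> u'" by (simp only: comp_cancel_right[OF u'(3)])
      then have h1_left: "h1 \<in> par (I \<inter> {..<k} \<union> {Suc k..<l})"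
        using par_comp par_mono[of "I \<inter> {..<k}" "I \<inter> {..<k} \<union> {Suc k..<l}"]
          par_mono[of "{Suc k..<l}" "I \<inter> {..<k} \<union> {Suc k..<l}"] g(1) u'(1) by blast
      have sub_s: "I \<inter> {..<k} \<union> {Suc k..<l} \<subseteq> {s..<l}" "J \<inter> {..<l} \<subseteq> {s..<l}"
        using I J k kl by auto
      have "l - s < e - s" using l by auto
      then have h1K: "h1 \<in> par ((I \<inter> {..<k} \<union> {Suc k..<l}) \<inter> (J \<inter> {..<l}))"
        by (rule less.hyps[OF _ sub_s lR h1_left h(1)])
      define K where "K = (I \<inter> {..<k} \<union> {Suc k..<l}) \<inter> (J \<inter> {..<l})"
      have K: "K \<subseteq> {..<R}" "k \<notin> K" using IR by (auto simp: K_def)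
      obtain a b where ab: "a \<in> par (K \<inter> {..<k})" "b \<in> par (K \<inter> {k<..})" "h1 = a \<circ> b"
        using par_split[OF K h1K[folded K_def]] .
      have "K \<inter> {..<k} \<subseteq> I \<inter> J \<inter> {..<k}" "K \<inter> {k<..} \<subseteq> J \<inter> {k<..<l}"
        by (auto simp: K_def)
      then have a: "a \<in> par (I \<inter> J \<inter> {..<k})" and b: "b \<in> par (J \<inter> {k<..<l})"
        using ab par_mono by blast+
      obtain a' where a': "a' \<in> par (I \<inter> J \<inter> {..<k})" "a' \<circ> a = id" "a \<circ> a' = id"
        using par_inverse[OF _ a] IR by blast
      have eq: "a' \<circ> g1 = b \<circ> u" using g1 ab(3) comp_cancel_left[OF a'(2)]
        by (simp only: comp_assoc)
      have "I \<inter> J \<inter> {..<k} \<subseteq> I \<inter> {..<k}" by blast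
      then have "a' \<circ> g1 \<in> par (I \<inter> {..<k})"
        using par_comp par_mono a'(1) g(1) by blast
      moreover have "b \<circ> u \<in> par {Suc k..<l}"
        using par_comp[OF _ u] b par_mono[of "J \<inter> {k<..<l}" "{Suc k..<l}"]
        by (auto simp: subset_iff)
      ultimately have "b \<circ> u \<in> par {Suc k..<k}" unfolding eq
        by (rule intervals) (use lR k less.prems in auto)
      then have bu: "b \<circ> u = id" by (simp add: par_def words_empty)
      have "g1 = a" using comp_cancel_left[OF a'(3), of g1] bu eq by simp
      have g2_eq: "g2 = b \<circ> h2" using comp_cancel_left[OF bu, of g2] \<open>u \<circ> g2 = h2\<close> by simp
      have sub_J: "J \<inter> {k<..<l} \<subseteq> J \<inter> {k<..}" "J \<inter> {l<..} \<subseteq> J \<inter> {k<..}" using kl by auto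
      have g2_right: "g2 \<in> par (J \<inter> {k<..})"
        unfolding g2_eq using par_comp sub_J[THEN par_mono] b h(2) by blast
      have sub_e: "I \<inter> {k<..} \<subseteq> {Suc k..<e}" "J \<inter> {k<..} \<subseteq> {Suc k..<e}"
        using I J by auto
      have "e - Suc k < e - s" using k by auto
      then have g2: "g2 \<in> par ((I \<inter> {k<..}) \<inter> (J \<inter> {k<..}))"
        by (rule less.hyps[OF _ sub_e less.prems(3) g(2) g2_right])
      have "g1 \<in> par (I \<inter> J)" using a \<open>g1 = a\<close> par_mono[of "I \<inter> J \<inter> {..<k}" "I \<inter> J"] by blast
      moreover have "g2 \<in> par (I \<inter> J)"
        using g2 par_mono[of "(I \<inter> {k<..}) \<inter> (J \<inter> {k<..})" "I \<inter> J"] by blast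
      ultimately show ?thesis using g(3) par_comp by blast
    qed
    show ?case
    proof (cases "I = {s..<e} \<or> J = {s..<e}")
      case True
      then show ?thesis using less.prems by (metis inf.absorb1 inf.absorb2)
    next
      case False
      then obtain k l where kl: "k \<in> {s..<e}" "k \<notin> I" "l \<in> {s..<e}" "l \<notin> J"
        using less.prems by blast
      show ?thesis
      proof (cases "k \<le> l")
        case True
        then show ?thesis using core[of I J k l] less.prems kl by blast
      next
        case False
        then show ?thesis using core[of J I l k] less.prems kl by (simp add: inf_commute)
      qed
    qed
  qed
  from this[of I 0 R J] show "par I \<inter> par J \<subseteq> par (I \<inter> J)" using IJ by (auto simp: atLeast0LessThan)
qed

end

section \<open>Three-cycles and alternating groups\<close>

text \<open>
  Away from \<open>p\<close>, each point is moved by at most one of \<open>\<alpha>\<close> and \<open>\<beta>\<close>, so that \<open>\<alpha>\<close> and \<open>\<beta>\<close> commute except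
  near \<open>p\<close>.  The commutator is the 3-cycle \<open>\<beta> p \<mapsto> p \<mapsto> \<alpha> p \<mapsto> \<beta> p\<close>, written as a product of transpositions.
\<close>

lemma commutator_three_cycle:
  assumes \<alpha>: "\<alpha> \<circ> \<alpha>' = id" "\<alpha>' \<circ> \<alpha> = id" and \<beta>: "\<beta> \<circ> \<beta>' = id" "\<beta>' \<circ> \<beta> = id"
    and disj: "\<And>x. x \<noteq> p \<Longrightarrow> \<alpha> x = x \<or> \<beta> x = x"
    and moves: "\<alpha> p \<noteq> p" "\<beta> p \<noteq> p"
  shows "\<alpha> \<circ> \<beta> \<circ> \<alpha>' \<circ> \<beta>' = transpose p (\<beta> p) \<circ> transpose p (\<alpha> p)"
proof
  fix x
  have A: "\<alpha> (\<alpha>' y) = y" and A': "\<alpha>' (\<alpha> y) = y"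
    and B: "\<beta> (\<beta>' y) = y" and B': "\<beta>' (\<beta> y) = y" for y
    using \<alpha> \<beta> by (simp_all add: fun_eq_iff)
  have inj: "\<alpha> y = \<alpha> z \<longleftrightarrow> y = z" "\<beta> y = \<beta> z \<longleftrightarrow> y = z" for y z
    by (metis A') (metis B')
  have fix_w: "\<alpha> (\<beta> p) = \<beta> p" using disj[of "\<beta> p"] moves(2) by (auto simp: inj)
  have fix_u: "\<beta> (\<alpha> p) = \<alpha> p" using disj[of "\<alpha> p"] moves(1) by (auto simp: inj)
  have uw: "\<alpha> p \<noteq> \<beta> p" using fix_w moves inj by metis
  have u': "\<beta>' (\<alpha> p) = \<alpha> p" using B'[of "\<alpha> p"] fix_u by simp
  consider "x = p" | "x = \<alpha> p" | "x = \<beta> p" | "x \<noteq> p" "x \<noteq> \<alpha> p" "x \<noteq> \<beta> p" by blast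
  then show "(\<alpha> \<circ> \<beta> \<circ> \<alpha>' \<circ> \<beta>') x = (transpose p (\<beta> p) \<circ> transpose p (\<alpha> p)) x"
  proof cases
    case 1
    have ne: "\<beta>' p \<noteq> p" using B[of p] moves(2) by auto
    then have "\<alpha> (\<beta>' p) = \<beta>' p" using disj[of "\<beta>' p"] B[of p] by auto
    then have "\<alpha>' (\<beta>' p) = \<beta>' p" using A'[of "\<beta>' p"] by simp
    then show ?thesis using 1 B uw moves by simp
  next
    case 2
    then show ?thesis using u' A' fix_w uw moves by simp
  next
    case 3
    have "\<alpha>' p \<noteq> p" using A[of p] moves(1) by auto
    then have "\<beta> (\<alpha>' p) = \<alpha>' p" using disj[of "\<alpha>' p"] A[of p] by auto
    then show ?thesis using 3 A B' uw moves by simp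
  next
    case 4
    have "\<alpha> (\<beta> (\<alpha>' (\<beta>' x))) = x"
    proof (cases "\<beta> x = x")
      case True
      then have "\<beta>' x = x" using B'[of x] by simp
      moreover have "\<beta> (\<alpha>' x) = \<alpha>' x"
      proof (cases "\<alpha>' x = x")
        case False
        have "\<alpha>' x \<noteq> p" using 4(2) A[of x] by auto
        then show ?thesis using disj[of "\<alpha>' x"] A[of x] False by auto
      qed (use True in simp)
      ultimately show ?thesis using A by simp
    next
      case False
      have "\<beta>' x \<noteq> p" using 4(3) B[of x] by auto
      moreover have "\<beta>' x \<noteq> x" using False B[of x] by auto
      ultimately have "\<alpha> (\<beta>' x) = \<beta>' x" using disj[of "\<beta>' x"] B[of x] by auto
      then have "\<alpha>' (\<beta>' x) = \<beta>' x" using A'[of "\<beta>' x"] by simp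
      moreover have "\<alpha> x = x" using disj[of x] False 4 by auto
      ultimately show ?thesis using B by simp
    qed
    then show ?thesis using 4 by simp
  qed
qed

text \<open>
  A product of two distinct transpositions of a three-element set is the 3-cycle \<open>c\<close> or \<open>c \<circ> c\<close>.
\<close>

lemma three_cycle_transposition_products:
  assumes comp: "\<And>f g. f \<in> H \<Longrightarrow> g \<in> H \<Longrightarrow> f \<circ> g \<in> H"
    and dist: "x \<noteq> y" "x \<noteq> z" "y \<noteq> z"
    and c: "transpose x y \<circ> transpose x z \<in> H"
  shows "transpose x z \<circ> transpose x y \<in> H" "transpose y z \<circ> transpose x y \<in> H"
    "transpose x y \<circ> transpose y z \<in> H" "transpose x z \<circ> transpose y z \<in> H"
proof -
  have "transpose x z \<circ> transpose x y
      = (transpose x y \<circ> transpose x z) \<circ> (transpose x y \<circ> transpose x z)"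
    using dist by (auto simp: fun_eq_iff transpose_def)
  then show 1: "transpose x z \<circ> transpose x y \<in> H" using comp[OF c c] by simp
  have "transpose y z \<circ> transpose x y = transpose x y \<circ> transpose x z"
    using dist by (auto simp: fun_eq_iff transpose_def)
  then show "transpose y z \<circ> transpose x y \<in> H" using c by simp
  have "transpose x y \<circ> transpose y z = transpose x z \<circ> transpose x y"
    using dist by (auto simp: fun_eq_iff transpose_def)
  then show "transpose x y \<circ> transpose y z \<in> H" using 1 by simp
  have "transpose x z \<circ> transpose y z = transpose x y \<circ> transpose x z"
    using dist by (auto simp: fun_eq_iff transpose_def)
  then show "transpose x z \<circ> transpose y z \<in> H" using c by simp
qed

text \<open>
  Two transpositions are regarded as similar if their product lies in \<open>H\<close>.  A 3-cycle in \<open>H\<close> makes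
  the three transpositions of its points similar to each other.  Starting from the
  3-cycles \<open>(p a b)\<close>, all transpositions of the set turn out to be similar to one fixed
  transposition \<open>t0\<close>, and an even permutation is a product of an even number of transpositions.
\<close>

lemma alternating_from_three_cycles:
  fixes H :: "('a \<Rightarrow> 'a) set"
  assumes id_H: "id \<in> H" and comp: "\<And>f g. f \<in> H \<Longrightarrow> g \<in> H \<Longrightarrow> f \<circ> g \<in> H"
    and fin: "finite A" "finite B" and ne: "A \<noteq> {}" "B \<noteq> {}"
    and disj: "A \<inter> B = {}" "p \<notin> A" "p \<notin> B"
    and cyc: "\<And>a b. a \<in> A \<Longrightarrow> b \<in> B \<Longrightarrow> transpose p b \<circ> transpose p a \<in> H"
    and q: "q permutes insert p (A \<union> B)" "evenperm q"
  shows "q \<in> H"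
proof -
  let ?T = "insert p (A \<union> B)"
  have finT: "finite ?T" using fin by simp
  obtain a0 b0 where a0: "a0 \<in> A" and b0: "b0 \<in> B" using ne by blast
  define t0 where "t0 = transpose p b0"
  have t0t0: "t0 \<circ> t0 = id" by (simp add: t0_def)
  define sim where "sim t \<longleftrightarrow> t \<circ> t0 \<in> H \<and> t0 \<circ> t \<in> H" for t
  have sim_trans: "sim s" if "sim t" "t \<circ> t = id" "s \<circ> t \<in> H" "t \<circ> s \<in> H" for s t
  proof -
    have "s \<circ> t0 = (s \<circ> t) \<circ> (t \<circ> t0)" "t0 \<circ> s = (t0 \<circ> t) \<circ> (t \<circ> s)"
      using that(2) by (simp_all add: fun_eq_iff)
    then show ?thesis using that comp unfolding sim_def by metis
  qed
  have sim_comp: "s \<circ> t \<in> H" if "sim s" "sim t" for s t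
  proof -
    have "s \<circ> t = (s \<circ> t0) \<circ> (t0 \<circ> t)" using t0t0 by (simp add: fun_eq_iff)
    then show ?thesis using that comp unfolding sim_def by metis
  qed
  have tri: "transpose p a \<circ> transpose p b \<in> H" "transpose a b \<circ> transpose p b \<in> H"
    "transpose p b \<circ> transpose a b \<in> H" if "a \<in> A" "b \<in> B" for a b
  proof -
    have d: "p \<noteq> b" "p \<noteq> a" "b \<noteq> a" using that disj by auto
    note t = three_cycle_transposition_products[of H p b a, OF comp d cyc[OF that]]
    show "transpose p a \<circ> transpose p b \<in> H" "transpose a b \<circ> transpose p b \<in> H"
      "transpose p b \<circ> transpose a b \<in> H"
      using t by (simp_all add: transpose_commute[of b a])
  qed
  have sim_t0: "sim t0" using t0t0 id_H by (simp add: sim_def)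
  have sim_pa: "sim (transpose p a)" if "a \<in> A" for a
    using tri(1)[OF that b0] cyc[OF that b0] by (simp add: sim_def t0_def)
  have sim_pb: "sim (transpose p b)" if "b \<in> B" for b
    by (rule sim_trans[OF sim_pa[OF a0]]) (use tri(1)[OF a0 that] cyc[OF a0 that] in auto)
  have sim_ab: "sim (transpose a b)" if "a \<in> A" "b \<in> B" for a b
    by (rule sim_trans[OF sim_pb[OF that(2)]]) (use tri[OF that] in auto)
  \<comment> \<open>Two transpositions through \<open>c\<close> are similar, so the 3-cycle on \<open>c, x, y\<close> lies in \<open>H\<close>.\<close>
  have sim_star: "sim (transpose x y)" if "x \<noteq> y" "x \<noteq> c" "y \<noteq> c"
    "sim (transpose c x)" "sim (transpose c y)" for x y c
  proof (rule sim_trans[OF that(4)])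
    note t = three_cycle_transposition_products[of H c x y, OF comp _ _ that(1)
        sim_comp[OF that(4,5)]]
    show "transpose x y \<circ> transpose c x \<in> H" "transpose c x \<circ> transpose x y \<in> H"
      using t that by auto
  qed simp
  have sim_all: "sim (transpose x y)" if "x \<in> ?T" "y \<in> ?T" "x \<noteq> y" for x y
  proof -
    have ab: "sim (transpose b a)" if "a \<in> A" "b \<in> B" for a b
      using sim_ab[OF that] by (simp add: transpose_commute)
    have pz: "sim (transpose p z)" if "z \<in> A \<union> B" for z using that sim_pa sim_pb by blast
    show ?thesis
    proof (cases "x = p \<or> y = p")
      case True
      then show ?thesis
        using that pz[of x] pz[of y] transpose_commute[of p x] by auto
    next
      case False
      then show ?thesis using that sim_star[of x y p] pz by auto
    qed
  qed
  have "if evenperm q then q \<in> H else t0 \<circ> q \<in> H"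
    using q(1) finT
  proof (induction rule: permutes_induct)
    case id
    show "if evenperm id then id \<in> H else t0 \<circ> id \<in> H" using id_H by simp
  next
    case (swap a b q)
    have ab: "a \<in> ?T" "b \<in> ?T" "a \<noteq> b" and IH: "if evenperm q then q \<in> H else t0 \<circ> q \<in> H"
      and qT: "q permutes ?T" using swap by auto
    have "permutation q" unfolding permutation_permutes by (intro exI[of _ ?T] conjI finT qT)
    then have ev: "evenperm (transpose a b \<circ> q) \<longleftrightarrow> \<not> evenperm q"
      using ab(3) by (simp add: evenperm_comp[OF permutation_swap_id] evenperm_swap)
    have s: "sim (transpose a b)" using sim_all ab by blast
    show "if evenperm (transpose a b \<circ> q) then transpose a b \<circ> q \<in> H
      else t0 \<circ> (transpose a b \<circ> q) \<in> H"
    proof (cases "evenperm q")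
      case True
      have "(t0 \<circ> transpose a b) \<circ> q \<in> H" using s True IH comp unfolding sim_def by auto
      then show ?thesis using True ev by (simp add: comp_assoc)
    next
      case False
      have "(transpose a b \<circ> t0) \<circ> (t0 \<circ> q) \<in> H" using s False IH comp unfolding sim_def by auto
      moreover have "(transpose a b \<circ> t0) \<circ> (t0 \<circ> q) = transpose a b \<circ> q"
        using t0t0 by (simp add: fun_eq_iff)
      ultimately have "transpose a b \<circ> q \<in> H" by simp
      then show ?thesis using False ev by simp
    qed
  qed
  then show ?thesis using q(2) by simp
qed

section \<open>Signed column permutations of a ladder\<close>

text \<open>
  A point is given by its column and its row, so that flips become negations.  Columns are
  numbered from 0, as are the generators; the row of even labels, which contains the
  central point, is the one marked by \<open>True\<close>.
\<close>

definition pt :: "nat \<Rightarrow> bool \<Rightarrow> nat" where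
  "pt c d = 2 * c + 1 + of_bool d"

lemma pt_eq_iff [simp]: "pt c d = pt c' d' \<longleftrightarrow> c = c' \<and> d = d'"
  by (cases d; cases d'; simp add: pt_def; presburger)

lemma pt_neq_0 [simp]: "pt c d \<noteq> 0" "0 \<noteq> pt c d"
  by (simp_all add: pt_def)

lemma pt_exhaust: obtains "x = 0" | c d where "x = pt c d"
proof (cases "x = 0")
  case False
  then have "x = pt ((x - 1) div 2) (odd (x - 1))" by (auto simp: pt_def elim: oddE)
  then show thesis using that by blast
qed

lemma pt_le: "pt c d \<le> 2 * n + 2 \<longleftrightarrow> c \<le> n"
  by (cases d) (auto simp: pt_def)

text \<open>
  The signed permutation that moves column \<open>c\<close> to column \<open>\<pi> c\<close> and interchanges its two
  entries if \<open>F c\<close> holds.  The label 0 belongs to no column and is fixed.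
\<close>

definition ladder :: "(nat \<Rightarrow> nat) \<Rightarrow> (nat \<Rightarrow> bool) \<Rightarrow> nat \<Rightarrow> nat" where
  "ladder \<pi> F x = (if x = 0 then 0 else pt (\<pi> ((x - 1) div 2)) (odd (x - 1) \<noteq> F ((x - 1) div 2)))"

lemma ladder_0 [simp]: "ladder \<pi> F 0 = 0"
  by (simp add: ladder_def)

lemma ladder_pt [simp]: "ladder \<pi> F (pt c d) = pt (\<pi> c) (d \<noteq> F c)"
  by (cases d) (simp_all add: ladder_def pt_def)

lemma fun_eq_pt:
  assumes "f 0 = g 0" "\<And>c d. f (pt c d) = g (pt c d)"
  shows "f = g"
proof
  fix x show "f x = g x" by (rule pt_exhaust[of x]) (use assms in auto)
qed

lemma ladder_comp:
  "ladder \<pi> F \<circ> ladder \<rho> E = ladder (\<pi> \<circ> \<rho>) (\<lambda>c. E c \<noteq> F (\<rho> c))"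
  by (rule fun_eq_pt) auto

lemma ladder_id: "ladder id (\<lambda>_. False) = id"
  by (rule fun_eq_pt) auto

definition rung :: "nat \<Rightarrow> nat \<Rightarrow> nat \<Rightarrow> nat" where
  "rung b i = ladder (transpose i (Suc i)) (\<lambda>c. i = Suc b \<and> c \<le> b)"

lemma rung_pt: "rung b i (pt c d) = pt (transpose i (Suc i) c) (d \<noteq> (i = Suc b \<and> c \<le> b))"
  by (simp add: rung_def)

lemma rung_0: "rung b i 0 = 0"
  by (simp add: rung_def)

lemma rung_invol: "rung b i \<circ> rung b i = id"
  by (rule fun_eq_pt) (auto simp: rung_pt rung_0 transpose_def)

lemma rung_commute: "i + 2 \<le> j \<Longrightarrow> rung b i \<circ> rung b j = rung b j \<circ> rung b i"
  by (rule fun_eq_pt) (auto simp: rung_pt rung_0 transpose_def)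

lemma rung_fixes:
  assumes "x = 0 \<or> 2 * i + 4 < x"
  shows "rung b i x = x"
proof (rule pt_exhaust[of x])
  fix c d assume x: "x = pt c d"
  then have "Suc i < c" using assms by (cases d) (auto simp: pt_def)
  then show ?thesis unfolding x by (auto simp: rung_pt)
qed (simp add: rung_0)

lemma involution_permutes:
  assumes "f \<circ> f = id" "\<And>x. x \<notin> S \<Longrightarrow> f x = x"
  shows "f permutes S"
proof -
  have "f (f x) = x" for x using assms(1) by (simp add: fun_eq_iff)
  then show ?thesis unfolding permutes_def using assms(2) by metis
qed

lemma rung_permutes: "i < r \<Longrightarrow> rung b i permutes {1..2 * r + 2}"
  by (rule involution_permutes[OF rung_invol]) (auto intro!: rung_fixes)

lemma h_perm_ladder: "h_perm i = ladder (transpose i (Suc i)) (\<lambda>_. False)"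
proof (rule fun_eq_pt)
  show "h_perm i 0 = ladder (transpose i (Suc i)) (\<lambda>_. False) 0"
    by (simp add: h_perm_def transpose_def)
  fix c d
  show "h_perm i (pt c d) = ladder (transpose i (Suc i)) (\<lambda>_. False) (pt c d)"
    unfolding h_perm_def comp_apply ladder_pt
    by (cases d) (simp_all add: pt_def transpose_def)
qed

lemma pairs_perm_Suc: "pairs_perm (Suc m) = pairs_perm m \<circ> transpose (2 * m + 1) (2 * m + 2)"
proof -
  have *: "foldr (\<lambda>c p. transpose (2*c - 1) (2*c) \<circ> p) xs (q :: nat \<Rightarrow> nat)
      = foldr (\<lambda>c p. transpose (2*c - 1) (2*c) \<circ> p) xs id \<circ> q" for xs q
    by (induction xs) (auto simp: comp_assoc)
  show ?thesis using *[of "[1..<Suc m]" "transpose (2 * m + 1) (2 * m + 2)"]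
    by (simp add: pairs_perm_def)
qed

lemma pairs_perm_ladder: "pairs_perm m = ladder id (\<lambda>c. c < m)"
proof (induction m)
  case 0
  have "pairs_perm 0 = id" by (simp add: pairs_perm_def)
  then show ?case by (simp only: not_less0 ladder_id)
next
  case (Suc m)
  have t: "transpose (2 * m + 1) (2 * m + 2) = ladder id (\<lambda>c. c = m)"
  proof (rule fun_eq_pt)
    fix c d
    show "transpose (2 * m + 1) (2 * m + 2) (pt c d) = ladder id (\<lambda>c. c = m) (pt c d)"
      unfolding ladder_pt by (cases d) (simp_all add: transpose_def pt_def)
  qed (simp add: transpose_def)
  show ?case unfolding pairs_perm_Suc Suc.IH t ladder_comp
    by (rule fun_eq_pt) auto
qed

lemma Gamma_gens_rung:
  assumes "i < b + t"
  shows "Gamma_gens b t ! i = rung b i"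
proof (cases "i = Suc b")
  case True
  have "h_perm i \<circ> pairs_perm (b + 1) = rung b i"
    unfolding h_perm_ladder pairs_perm_ladder ladder_comp rung_def using True
    by (auto simp: less_Suc_eq_le)
  then show ?thesis using assms True by (simp add: Gamma_gens_def)
next
  case False
  then show ?thesis using assms by (simp add: Gamma_gens_def h_perm_ladder rung_def)
qed

lemma permutation_comp_transpose: "permutation p \<Longrightarrow> permutation (p \<circ> transpose a b)"
  by (rule permutation_compose[OF _ permutation_swap_id])

text \<open>
  The parity of \<open>b\<close> enters here: the extra factor of the generator with index \<open>b + 1\<close> consists of
  \<open>b + 1\<close> transpositions.
\<close>

lemma evenperm_pairs_perm: "permutation (pairs_perm m) \<and> (evenperm (pairs_perm m) \<longleftrightarrow> even m)"
proof (induction m)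
  case 0
  have "pairs_perm 0 = id" by (simp add: pairs_perm_def)
  then show ?case by (simp only: permutation_id evenperm_id) simp
next
  case (Suc m)
  let ?t = "transpose (2 * m + 1) (2 * m + 2)"
  have "permutation (pairs_perm m \<circ> ?t)"
    using Suc.IH by (intro permutation_comp_transpose) blast
  moreover have "evenperm (pairs_perm m \<circ> ?t) \<longleftrightarrow> evenperm (pairs_perm m) = evenperm ?t"
    using Suc.IH by (intro evenperm_comp permutation_swap_id) blast
  moreover have "\<not> evenperm ?t" unfolding evenperm_swap by simp
  ultimately show ?case unfolding pairs_perm_Suc using Suc.IH by (metis even_Suc)
qed

lemma evenperm_h_perm: "permutation (h_perm i) \<and> evenperm (h_perm i)"
  unfolding h_perm_def
  by (simp add: permutation_comp_transpose permutation_swap_id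
      evenperm_comp[OF permutation_swap_id permutation_swap_id] evenperm_swap)

lemma rung_evenperm:
  assumes "odd b"
  shows "permutation (rung b i)" "evenperm (rung b i)"
proof -
  have r: "rung b i = Gamma_gens b (Suc i) ! i" by (simp add: Gamma_gens_rung)
  have "Gamma_gens b (Suc i) ! i
      = (if i = b + 1 then h_perm i \<circ> pairs_perm (b + 1) else h_perm i)"
    by (simp add: Gamma_gens_def del: upt_Suc)
  moreover have "permutation (h_perm i \<circ> pairs_perm (b + 1))"
    "evenperm (h_perm i \<circ> pairs_perm (b + 1))"
    using evenperm_h_perm[of i] evenperm_pairs_perm[of "b + 1"] assms
      permutation_compose[of "h_perm i" "pairs_perm (b + 1)"]
      evenperm_comp[of "h_perm i" "pairs_perm (b + 1)"] by auto
  ultimately show "permutation (rung b i)" "evenperm (rung b i)"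
    unfolding r using evenperm_h_perm[of i] by auto
qed

section \<open>The glued generators\<close>

definition mirror :: "nat \<Rightarrow> nat \<Rightarrow> nat" where
  "mirror N x = (if 1 \<le> x \<and> x \<le> N then N + 1 - x else x)"

lemma mirror_mirror: "mirror N \<circ> mirror N = id"
  by (auto simp: fun_eq_iff mirror_def)

lemma mirror_permutes: "mirror N permutes {1..N}"
  by (rule involution_permutes[OF mirror_mirror]) (auto simp: mirror_def)

definition gen :: "nat \<Rightarrow> nat \<Rightarrow> nat \<Rightarrow> nat \<Rightarrow> nat" where
  "gen b r i = (if i < r then rung b i
     else mirror (4 * r + 3) \<circ> rung b (2 * r - 1 - i) \<circ> mirror (4 * r + 3))"

text \<open>
  With equal parameters on both sides, the relabelling of the second point set is the restriction of
  the reversal of all points, so transporting along it is conjugation by that reversal.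
\<close>

lemma glue_gens_gen:
  "glue_gens b t b t = map (gen b (b + t)) [0..<2 * (b + t)]"
proof -
  define r where "r = b + t"
  define N where "N = 4 * r + 3"
  define lab where "lab = glue_label b t b t"
  have lab: "lab x = N + 1 - x" for x
    by (simp add: lab_def glue_label_def glue_degree_def N_def r_def)
  define P where "P = Gamma_points b t"
  have P: "P = {1..2 * r + 2}" by (simp add: P_def Gamma_points_def r_def)
  have inj: "inj_on lab P" unfolding inj_on_def P N_def lab by auto
  have mp: "map_permutation P lab p = mirror N \<circ> p \<circ> mirror N" if p: "p permutes P" for p
  proof
    fix x
    show "map_permutation P lab p x = (mirror N \<circ> p \<circ> mirror N) x"
    proof (cases "x \<in> lab ` P")
      case True
      then obtain y where y: "y \<in> P" "x = lab y" by blast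
      have py: "p y \<in> P" using p y by (simp add: permutes_in_image)
      have "map_permutation P lab p x = lab (p y)"
        unfolding y(2) by (rule map_permutation_apply[OF inj y(1)])
      moreover have "mirror N x = y" "mirror N (p y) = lab (p y)"
        using y py by (auto simp: P lab mirror_def N_def)
      ultimately show ?thesis by simp
    next
      case False
      have "mirror N x \<notin> P"
      proof
        assume m: "mirror N x \<in> P"
        have "lab (mirror N x) = x" using m by (auto simp: lab mirror_def P N_def split: if_splits)
        then show False using False m by (metis imageI)
      qed
      then have "p (mirror N x) = mirror N x" using p by (simp add: permutes_not_in)
      moreover have "mirror N (mirror N x) = x"
        using mirror_mirror[of N] by (simp add: fun_eq_iff)
      ultimately show ?thesis using False by (simp add: map_permutation_def)
    qed
  qed
  show ?thesis
  proof (rule nth_equalityI)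
    show "length (glue_gens b t b t) = length (map (gen b (b + t)) [0..<2 * (b + t)])"
      by (simp add: glue_gens_def Let_def)
    fix i assume "i < length (glue_gens b t b t)"
    then have i: "i < 2 * r" by (simp add: glue_gens_def Let_def r_def)
    have nth: "glue_gens b t b t ! i = (if i < r then Gamma_gens b t ! i
       else map_permutation P lab (Gamma_gens b t ! (r + r - 1 - i)))"
      using i by (simp add: glue_gens_def Let_def r_def P_def lab_def)
    have "glue_gens b t b t ! i = gen b r i"
    proof (cases "i < r")
      case True
      then show ?thesis using nth by (simp add: gen_def Gamma_gens_rung r_def)
    next
      case False
      then have j: "r + r - 1 - i < b + t" using i by (simp add: r_def)
      have "rung b (2 * r - 1 - i) permutes P"
        unfolding P by (rule rung_permutes) (use False i in auto)
      from mp[OF this] show ?thesis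
        unfolding nth Gamma_gens_rung[OF j] gen_def N_def using False by (simp add: mult_2)
    qed
    then show "glue_gens b t b t ! i = map (gen b (b + t)) [0..<2 * (b + t)] ! i"
      using i by (simp add: r_def)
  qed
qed

lemma gen_left: "i < r \<Longrightarrow> gen b r i = rung b i"
  by (simp add: gen_def)

lemma conj_mirror_twice:
  "mirror N \<circ> (mirror N \<circ> f \<circ> mirror N) \<circ> mirror N = f"
  using mirror_mirror[of N] by (simp add: fun_eq_iff)

lemma mirror_gen:
  assumes "i < 2 * r"
  shows "mirror (4 * r + 3) \<circ> gen b r i \<circ> mirror (4 * r + 3) = gen b r (2 * r - 1 - i)"
proof (cases "i < r")
  case True
  then have "\<not> 2 * r - 1 - i < r" "2 * r - 1 - (2 * r - 1 - i) = i" by auto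
  then show ?thesis using True unfolding gen_def by simp
next
  case False
  then have "2 * r - 1 - i < r" using assms by auto
  then show ?thesis using False unfolding gen_def by (simp only: if_True if_False conj_mirror_twice)
qed

lemma gen_invol: "gen b r i \<circ> gen b r i = id"
  using rung_invol[of b] mirror_mirror[of "4 * r + 3"] by (simp add: gen_def fun_eq_iff)

lemma gen_fixes_above:
  assumes "i < r" "x = 0 \<or> 2 * i + 4 < x"
  shows "gen b r i x = x"
  using assms rung_fixes by (simp add: gen_def)

lemma gen_fixes_below:
  assumes "r \<le> i" "i < 2 * r" "x < 2 * i + 2 \<or> x > 4 * r + 3"
  shows "gen b r i x = x"
proof -
  have "rung b (2 * r - 1 - i) (mirror (4 * r + 3) x) = mirror (4 * r + 3) x"
    by (rule rung_fixes) (use assms in \<open>auto simp: mirror_def\<close>)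
  moreover have "mirror (4 * r + 3) (mirror (4 * r + 3) x) = x"
    using mirror_mirror[of "4 * r + 3"] by (simp add: fun_eq_iff)
  ultimately show ?thesis using assms by (simp add: gen_def)
qed

lemma gen_permutes:
  assumes "i < 2 * r"
  shows "gen b r i permutes {1..4 * r + 3}"
proof (rule involution_permutes[OF gen_invol])
  fix x assume "x \<notin> {1..4 * r + 3}"
  then show "gen b r i x = x"
    using gen_fixes_above[of i r x b] gen_fixes_below[of r i x b] assms by (cases "i < r") auto
qed

lemma gen_evenperm:
  assumes "odd b"
  shows "evenperm (gen b r i)"
proof -
  have m: "permutation (mirror N)" for N
    unfolding permutation_permutes using mirror_permutes by blast
  have "evenperm (mirror N \<circ> rung b j \<circ> mirror N)" for N j
    using m[of N] rung_evenperm[OF assms, of j]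
    by (simp add: evenperm_comp permutation_compose)
  then show ?thesis using rung_evenperm[OF assms] by (simp add: gen_def)
qed

lemma commute_if_disjoint_support:
  assumes "inj f" "inj g" "\<And>x. f x = x \<or> g x = x"
  shows "f \<circ> g = g \<circ> f"
proof
  fix x
  show "(f \<circ> g) x = (g \<circ> f) x"
  proof (cases "f x = x")
    case True
    then show ?thesis using assms(3)[of "g x"] injD[OF assms(2), of "g x" x] by auto
  next
    case False
    then have "f (f x) \<noteq> f x" using injD[OF assms(1)] by metis
    then show ?thesis using assms(3)[of x] assms(3)[of "f x"] False by auto
  qed
qed

lemma inj_gen: "inj (gen b r i)"
  using gen_invol[of b r i] by (metis inj_on_id inj_on_imageI2)

text \<open>
  On one side of the centre this is a property of column permutations.  Across the centre, the
  support of the left generator \<open>i\<close> ends at \<open>2 * i + 4\<close> and that of the right generator \<open>j\<close> starts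
  at \<open>2 * j + 2\<close>.
\<close>

lemma gen_commute:
  assumes "i + 2 \<le> j" "j < 2 * r"
  shows "gen b r i \<circ> gen b r j = gen b r j \<circ> gen b r i"
proof -
  consider "j < r" | "i < r" "r \<le> j" | "r \<le> i" by linarith
  then show ?thesis
  proof cases
    case 1
    then show ?thesis using rung_commute[OF assms(1)] assms(1) by (simp add: gen_def)
  next
    case 2
    show ?thesis
    proof (rule commute_if_disjoint_support[OF inj_gen inj_gen])
      fix x
      show "gen b r i x = x \<or> gen b r j x = x"
        using gen_fixes_above[of i r x b] gen_fixes_below[of r j x b] 2 assms by linarith
    qed
  next
    case 3
    have c: "rung b (2 * r - 1 - j) \<circ> rung b (2 * r - 1 - i)
        = rung b (2 * r - 1 - i) \<circ> rung b (2 * r - 1 - j)"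
      by (rule rung_commute) (use assms in linarith)
    let ?m = "mirror (4 * r + 3)"
    have conj: "(?m \<circ> f \<circ> ?m) \<circ> (?m \<circ> g \<circ> ?m) = ?m \<circ> (f \<circ> g) \<circ> ?m" for f g
      using mirror_mirror[of "4 * r + 3"] by (simp add: fun_eq_iff)
    have "\<not> i < r" "\<not> j < r" using 3 assms by auto
    then show ?thesis unfolding gen_def by (simp only: if_False conj c)
  qed
qed

interpretation glued: string_involutions "gen b r" "2 * r" for b r
  by unfold_locales (use gen_invol gen_commute in auto)

section \<open>Parabolic subgroups on one side\<close>

text \<open>
  The function \<open>L\<close> lifts column permutations to signed ones.  It is left abstract because two
  different lifts are needed, the plain one without flips and a twisted one.
\<close>

lemma transpositions_from_adjacent:
  fixes s e :: nat
  assumes adj: "\<And>i. s \<le> i \<Longrightarrow> i < e \<Longrightarrow> L (transpose i (Suc i)) \<in> H"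
    and hom: "\<And>\<pi> \<rho>. \<pi> permutes {s..e} \<Longrightarrow> \<rho> permutes {s..e} \<Longrightarrow> L (\<pi> \<circ> \<rho>) = L \<pi> \<circ> L \<rho>"
    and id_H: "L id \<in> H" and comp: "\<And>f g. f \<in> H \<Longrightarrow> g \<in> H \<Longrightarrow> f \<circ> g \<in> H"
    and \<pi>: "\<pi> permutes {s..e}"
  shows "L \<pi> \<in> H"
proof -
  have ord: "L (transpose a b) \<in> H" if "s \<le> a" "a < b" "b \<le> e" for a b
    using that(2,3)
  proof (induction b)
    case (Suc b)
    show ?case
    proof (cases "a = b")
      case True
      then show ?thesis using adj[of a] that(1) Suc.prems by simp
    next
      case False
      then have ab: "a < b" using Suc.prems by simp
      let ?s = "transpose b (Suc b)" and ?t = "transpose a b"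
      have p: "?s permutes {s..e}" "?t permutes {s..e}" "?s \<circ> ?t permutes {s..e}"
        using ab that(1) Suc.prems by (auto intro!: permutes_swap_id permutes_compose)
      have "transpose a (Suc b) = (?s \<circ> ?t) \<circ> ?s"
        using ab by (auto simp: fun_eq_iff transpose_def)
      then have "L (transpose a (Suc b)) = (L ?s \<circ> L ?t) \<circ> L ?s"
        using hom p by metis
      moreover have "L ?s \<in> H" using adj[of b] that(1) ab Suc.prems by simp
      moreover have "L ?t \<in> H" using Suc.IH ab Suc.prems by simp
      ultimately show ?thesis using comp by metis
    qed
  qed simp
  have tr: "L (transpose a b) \<in> H" if "a \<in> {s..e}" "b \<in> {s..e}" "a \<noteq> b" for a b
    using ord[of a b] ord[of b a] that transpose_commute[of a b] by (cases a b rule: linorder_cases) auto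
  have fin: "finite {s..e}" by simp
  show ?thesis using \<pi> fin
  proof (induction rule: permutes_induct)
    case id
    show ?case by (rule id_H)
  next
    case (swap a b p)
    have "transpose a b permutes {s..e}" using swap by (intro permutes_swap_id) auto
    then have "L (transpose a b \<circ> p) = L (transpose a b) \<circ> L p" using hom swap by blast
    then show ?case using comp tr swap by metis
  qed
qed

lemma even_card_sym_diff:
  assumes "finite A" "finite B"
  shows "even (card {x. (x \<in> A) \<noteq> (x \<in> B)}) \<longleftrightarrow> (even (card A) \<longleftrightarrow> even (card B))"
proof -
  have eq: "{x. (x \<in> A) \<noteq> (x \<in> B)} = (A - B) \<union> (B - A)" by blast
  have "card ((A - B) \<union> (B - A)) = card (A - B) + card (B - A)"
    using assms by (intro card_Un_disjoint) auto
  moreover have "card A = card (A - B) + card (A \<inter> B)"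
    using assms(1) by (metis add.commute card_Int_Diff)
  moreover have "card B = card (B - A) + card (A \<inter> B)"
    using assms(2) by (metis add.commute card_Int_Diff inf_commute)
  ultimately show ?thesis unfolding eq by presburger
qed

lemma rung_ladder:
  "rung b i \<circ> ladder \<pi> F = ladder (transpose i (Suc i) \<circ> \<pi>) (\<lambda>c. F c \<noteq> (i = Suc b \<and> \<pi> c \<le> b))"
  by (simp only: rung_def ladder_comp)

text \<open>
  Multiplying by a further left generator changes column permutation and flips by the rule shown in
  the last assumption, so an invariant of pairs \<open>(\<pi>, F)\<close> need only be checked for this rule.
\<close>

lemma prefix_ladder_induct:
  assumes "e \<le> r" "g \<in> glued.par b r {..<e}"
    and "P id (\<lambda>_. False)"
    and "\<And>i \<pi> F. i < e \<Longrightarrow> \<pi> permutes {..e} \<Longrightarrow> P \<pi> F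
      \<Longrightarrow> P (transpose i (Suc i) \<circ> \<pi>) (\<lambda>c. F c \<noteq> (i = Suc b \<and> \<pi> c \<le> b))"
  obtains \<pi> F where "g = ladder \<pi> F" "\<pi> permutes {..e}" "P \<pi> F"
proof -
  have "\<exists>\<pi> F. g = ladder \<pi> F \<and> \<pi> permutes {..e} \<and> P \<pi> F"
    using assms(2) unfolding glued.par_def
  proof (induction rule: words.induct)
    case words_id
    show ?case using assms(3) ladder_id permutes_id by metis
  next
    case (words_step s g)
    then obtain \<pi> F where g: "g = ladder \<pi> F" "\<pi> permutes {..e}" "P \<pi> F" by blast
    obtain i where i: "i < e" "s = gen b r i" using words_step by blast
    then have s: "s = rung b i" using assms(1) by (simp add: gen_left)
    have "transpose i (Suc i) permutes {..e}" using i by (intro permutes_swap_id) auto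
    then have "transpose i (Suc i) \<circ> \<pi> permutes {..e}" using g(2) by (rule permutes_compose[rotated])
    then show ?case unfolding s g(1) rung_ladder using assms(4)[OF i(1) g(2,3)] by blast
  qed
  then show thesis using that by blast
qed

lemma prefix_small:
  assumes "e \<le> r" "e \<le> Suc b" "g \<in> glued.par b r {..<e}"
  obtains \<pi> where "g = ladder \<pi> (\<lambda>_. False)" "\<pi> permutes {..e}"
proof (rule prefix_ladder_induct[OF assms(1,3), of "\<lambda>\<pi> F. F = (\<lambda>_. False)"])
  show "(\<lambda>c. F c \<noteq> (i = Suc b \<and> \<pi> c \<le> b)) = (\<lambda>_. False)" if "i < e" "F = (\<lambda>_. False)" for i \<pi> F
    using that assms(2) by auto
qed (use that in auto)

text \<open>
  Interchanging the names of the two entries of column \<open>m\<close> turns a column permutation without flips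
  into one whose flips are \<open>twist m \<pi>\<close>: a flip occurs where column \<open>m\<close> is left or entered.
\<close>

definition twist :: "nat \<Rightarrow> (nat \<Rightarrow> nat) \<Rightarrow> nat \<Rightarrow> bool" where
  "twist m \<pi> c \<longleftrightarrow> c \<le> m \<and> (c = m) \<noteq> (\<pi> c = m)"

text \<open>
  The first \<open>b + 2\<close> generators, which include the flipping one but not the next, act on \<open>b + 3\<close>
  columns and generate far fewer than all even-signed permutations.  After renaming the
  entries of the last column, the generator \<open>b + 1\<close> is the swap of two columns followed by the flip
  of all \<open>b + 3\<close> columns, and the generators before it are swaps without flips.  Thus
  every element is a twisted lift of its column permutation, possibly followed by the flip of all
  columns, which is recorded by \<open>\<epsilon>\<close>.
\<close>

lemma prefix_middle:
  assumes "b + 2 \<le> r" "g \<in> glued.par b r {..<b + 2}"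
  obtains \<pi> \<epsilon> where "g = ladder \<pi> (\<lambda>c. twist (b + 2) \<pi> c \<noteq> (\<epsilon> \<and> c \<le> b + 2))" "\<pi> permutes {..b + 2}"
proof (rule prefix_ladder_induct[OF assms,
      of "\<lambda>\<pi> F. \<exists>\<epsilon>. F = (\<lambda>c. twist (b + 2) \<pi> c \<noteq> (\<epsilon> \<and> c \<le> b + 2))"])
  show "\<exists>\<epsilon>. (\<lambda>_. False) = (\<lambda>c. twist (b + 2) id c \<noteq> (\<epsilon> \<and> c \<le> b + 2))"
    by (rule exI[of _ False]) (simp add: twist_def)
next
  fix i \<pi> F
  assume i: "i < b + 2" and \<pi>: "\<pi> permutes {..b + 2}"
    and "\<exists>\<epsilon>. F = (\<lambda>c. twist (b + 2) \<pi> c \<noteq> (\<epsilon> \<and> c \<le> b + 2))"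
  then obtain \<epsilon> where F: "F = (\<lambda>c. twist (b + 2) \<pi> c \<noteq> (\<epsilon> \<and> c \<le> b + 2))" by blast
  have le: "\<pi> c \<le> b + 2 \<longleftrightarrow> c \<le> b + 2" for c using permutes_in_image[OF \<pi>, of c] by simp
  show "\<exists>\<epsilon>. (\<lambda>c. F c \<noteq> (i = Suc b \<and> \<pi> c \<le> b))
      = (\<lambda>c. twist (b + 2) (transpose i (Suc i) \<circ> \<pi>) c \<noteq> (\<epsilon> \<and> c \<le> b + 2))"
  proof (rule exI[of _ "\<epsilon> \<noteq> (i = Suc b)"], rule ext)
    fix c
    show "(F c \<noteq> (i = Suc b \<and> \<pi> c \<le> b)) = (twist (b + 2) (transpose i (Suc i) \<circ> \<pi>) c
        \<noteq> ((\<epsilon> \<noteq> (i = Suc b)) \<and> c \<le> b + 2))"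
      using le[of c] i unfolding F twist_def comp_apply transpose_def by auto
  qed
qed (use that in blast)

text \<open>
  Each generator flips either no column or \<open>b + 1\<close> of them, and \<open>b + 1\<close> is even.
\<close>

lemma prefix_large:
  assumes "odd b" "e \<le> r" "b + 2 \<le> e" "g \<in> glued.par b r {..<e}"
  obtains \<pi> F where "g = ladder \<pi> F" "\<pi> permutes {..e}"
    "\<And>c. F c \<Longrightarrow> c \<le> e" "even (card {c. F c})"
proof (rule prefix_ladder_induct[OF assms(2,4), of "\<lambda>\<pi> F. {c. F c} \<subseteq> {..e} \<and> even (card {c. F c})"])
  fix i \<pi> F
  assume i: "i < e" and \<pi>: "\<pi> permutes {..e}" and F: "{c. F c} \<subseteq> {..e} \<and> even (card {c. F c})"
  show "{c. F c \<noteq> (i = Suc b \<and> \<pi> c \<le> b)} \<subseteq> {..e}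
      \<and> even (card {c. F c \<noteq> (i = Suc b \<and> \<pi> c \<le> b)})"
  proof (cases "i = Suc b")
    case True
    have bij: "bij \<pi>" using \<pi> by (rule permutes_bij)
    have sub: "{c. \<pi> c \<le> b} \<subseteq> {..e}"
    proof
      fix c assume "c \<in> {c. \<pi> c \<le> b}"
      then show "c \<in> {..e}" using permutes_in_image[OF \<pi>, of c] assms(3) by auto
    qed
    have "card (\<pi> -` {..b}) = card {..b}"
      using bij by (intro card_vimage_inj) (auto simp: bij_def)
    then have "even (card {c. \<pi> c \<le> b})" using assms(1) by (simp add: vimage_def)
    then have "even (card {c. F c \<noteq> (\<pi> c \<le> b)})"
      using even_card_sym_diff[of "{c. F c}" "{c. \<pi> c \<le> b}"] F sub finite_subset[OF _ finite_atMost]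
      by auto
    then show ?thesis using F sub True by auto
  qed (use F in simp)
qed (use that in auto)

text \<open>
  What a final segment can do on the left ladder.  Its generators do not move the
  columns before \<open>s\<close>, and only the generator \<open>b + 1\<close> flips any of them; if it belongs to the
  segment, then these columns have index at most \<open>b\<close> and are flipped all together.  If \<open>s > b\<close>, the columns
  from \<open>s\<close> on are never flipped, so their odd points, which do not include the central point, cannot
  leave their row.
\<close>

lemma suffix_on_left:
  assumes "s \<le> r" "g \<in> glued.par b r {s..<2 * r}"
  obtains \<epsilon> where "\<epsilon> \<Longrightarrow> s \<le> Suc b" "\<And>c d. c < s \<Longrightarrow> g (pt c d) = pt c (d \<noteq> \<epsilon>)"
    "\<And>c. Suc b \<le> s \<Longrightarrow> s \<le> c \<Longrightarrow> c \<le> r \<Longrightarrow> \<exists>c'. s \<le> c' \<and> c' \<le> r \<and> g (pt c False) = pt c' False"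
proof -
  have "\<exists>\<epsilon>. (\<epsilon> \<longrightarrow> s \<le> Suc b) \<and> (\<forall>c d. c < s \<longrightarrow> g (pt c d) = pt c (d \<noteq> \<epsilon>)) \<and>
    (Suc b \<le> s \<longrightarrow> (\<forall>c. s \<le> c \<and> c \<le> r \<longrightarrow> (\<exists>c'. s \<le> c' \<and> c' \<le> r \<and> g (pt c False) = pt c' False)))"
    using assms(2) unfolding glued.par_def
  proof (induction rule: words.induct)
    case words_id
    show ?case by (rule exI[of _ False]) auto
  next
    case (words_step u g)
    then obtain \<epsilon> where e1: "\<epsilon> \<Longrightarrow> s \<le> Suc b" and e2: "\<And>c d. c < s \<Longrightarrow> g (pt c d) = pt c (d \<noteq> \<epsilon>)"
      and e3: "\<And>c. Suc b \<le> s \<Longrightarrow> s \<le> c \<Longrightarrow> c \<le> r \<Longrightarrow> \<exists>c'. s \<le> c' \<and> c' \<le> r \<and> g (pt c False) = pt c' False"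
      by blast
    obtain i where i: "s \<le> i" "i < 2 * r" "u = gen b r i" using words_step by auto
    show ?case
    proof (cases "i < r")
      case True
      then have u: "u = rung b i" using i by (simp add: gen_left)
      define \<delta> where "\<delta> \<longleftrightarrow> \<epsilon> \<noteq> (i = Suc b)"
      have "\<delta> \<longrightarrow> s \<le> Suc b" using e1 i(1) unfolding \<delta>_def by auto
      moreover have "(u \<circ> g) (pt c d) = pt c (d \<noteq> \<delta>)" if "c < s" for c d
        using that i(1) by (auto simp: e2[OF that] u rung_pt \<delta>_def)
      moreover have "\<exists>c'. s \<le> c' \<and> c' \<le> r \<and> (u \<circ> g) (pt c False) = pt c' False"
        if sb: "Suc b \<le> s" and c: "s \<le> c" "c \<le> r" for c
      proof -
        obtain c' where c': "s \<le> c'" "c' \<le> r" "g (pt c False) = pt c' False" using e3[OF sb c] by blast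
        have "(u \<circ> g) (pt c False) = pt (transpose i (Suc i) c') False"
          using sb c' by (simp add: u rung_pt)
        moreover have "s \<le> transpose i (Suc i) c'" "transpose i (Suc i) c' \<le> r"
          using c' i(1) True by (auto simp: transpose_def)
        ultimately show ?thesis by blast
      qed
      ultimately show ?thesis by blast
    next
      case False
      have fx: "u (pt c d) = pt c d" if "c < r \<or> c \<le> r \<and> \<not> d" for c d
        unfolding i(3) by (rule gen_fixes_below) (use that False i in \<open>auto simp: pt_def\<close>)
      have "(u \<circ> g) (pt c d) = pt c (d \<noteq> \<epsilon>)" if "c < s" for c d
        using that assms(1) by (simp add: e2[OF that] fx)
      moreover have "\<exists>c'. s \<le> c' \<and> c' \<le> r \<and> (u \<circ> g) (pt c False) = pt c' False"
        if sb: "Suc b \<le> s" and c: "s \<le> c" "c \<le> r" for c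
        using e3[OF sb c] fx by fastforce
      ultimately show ?thesis using e1 by blast
    qed
  qed
  then show thesis using that by blast
qed

lemma permutes_interval:
  fixes \<pi> :: "nat \<Rightarrow> nat"
  assumes "\<pi> permutes {..e}" "\<And>c. c < s \<Longrightarrow> \<pi> c = c"
  shows "\<pi> permutes {s..e}"
  using assms by (intro permutes_superset[OF assms(1)]) auto

context
  fixes b r s e :: nat
  assumes e: "e \<le> r"
begin

abbreviation "segment_group \<equiv> glued.par b r {s..<e}"

lemma rung_in: "s \<le> i \<Longrightarrow> i < e \<Longrightarrow> rung b i \<in> segment_group"
  using glued.par_gen[of i "{s..<e}" b r] e by (simp add: gen_left)

lemma plain_ladder_in:
  assumes "\<And>i. s \<le> i \<Longrightarrow> i < e \<Longrightarrow> ladder (transpose i (Suc i)) (\<lambda>_. False) \<in> segment_group"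
    and "\<pi> permutes {s..e}"
  shows "ladder \<pi> (\<lambda>_. False) \<in> segment_group"
proof (rule transpositions_from_adjacent[where L = "\<lambda>\<pi>. ladder \<pi> (\<lambda>_. False)", OF assms(1)])
  show "ladder id (\<lambda>_. False) \<in> segment_group" unfolding ladder_id by (rule glued.par_id)
qed (use assms(2) in \<open>auto simp: ladder_comp intro: glued.par_comp\<close>)

text \<open>
  The cube of the product of the generators \<open>b\<close> and \<open>b + 1\<close> is the flip of all \<open>b + 3\<close> columns: the columns before \<open>b\<close>
  are flipped three times, and each of the last three passes once through a flipped position.
  Up to this central element, the generators are the twisted lifts of adjacent transpositions.
\<close>

lemma twisted_ladder_in:
  assumes "e = b + 2" "s \<le> b" "\<pi> permutes {s..e}"
  shows "ladder \<pi> (\<lambda>c. twist (b + 2) \<pi> c \<noteq> (\<epsilon> \<and> c \<le> b + 2)) \<in> segment_group"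
proof -
  let ?J = "ladder id (\<lambda>c. c \<le> b + 2)"
  let ?x = "rung b b \<circ> rung b (Suc b)"
  have x: "?x \<in> segment_group" using rung_in[of b] rung_in[of "Suc b"] assms by (intro glued.par_comp) auto
  have "?x \<circ> (?x \<circ> ?x) = ?J"
    by (rule fun_eq_pt) (auto simp: rung_pt rung_0 transpose_def)
  then have J: "?J \<in> segment_group" using x glued.par_comp by metis
  have "ladder \<pi> (twist (b + 2) \<pi>) \<in> segment_group"
  proof (rule transpositions_from_adjacent[where L = "\<lambda>\<pi>. ladder \<pi> (twist (b + 2) \<pi>)"])
    fix i assume i: "s \<le> i" "i < e"
    show "ladder (transpose i (Suc i)) (twist (b + 2) (transpose i (Suc i))) \<in> segment_group"
    proof (cases "i = Suc b")
      case True
      have "ladder (transpose i (Suc i)) (twist (b + 2) (transpose i (Suc i))) = ?J \<circ> rung b i"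
        by (rule fun_eq_pt) (auto simp: True rung_pt rung_0 transpose_def twist_def)
      then show ?thesis using J rung_in[OF i] glued.par_comp by metis
    next
      case False
      then have "ladder (transpose i (Suc i)) (twist (b + 2) (transpose i (Suc i))) = rung b i"
        using i assms(1) by (intro fun_eq_pt) (auto simp: rung_pt rung_0 transpose_def twist_def)
      then show ?thesis using rung_in[OF i] by simp
    qed
  next
    fix \<pi> \<rho> :: "nat \<Rightarrow> nat" assume "\<pi> permutes {s..e}" and \<rho>: "\<rho> permutes {s..e}"
    have le: "\<rho> c \<le> b + 2 \<longleftrightarrow> c \<le> b + 2" for c
      using permutes_in_image[OF \<rho>, of c] permutes_not_in[OF \<rho>, of c] assms(1) by (cases "c \<in> {s..e}") auto
    show "ladder (\<pi> \<circ> \<rho>) (twist (b + 2) (\<pi> \<circ> \<rho>)) = ladder \<pi> (twist (b + 2) \<pi>) \<circ> ladder \<rho> (twist (b + 2) \<rho>)"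
      unfolding ladder_comp using le
      by (intro arg_cong[where f = "ladder (\<pi> \<circ> \<rho>)"]) (auto simp: twist_def fun_eq_iff)
  next
    have "twist (b + 2) id = (\<lambda>_. False)" by (simp add: twist_def fun_eq_iff)
    then show "ladder id (twist (b + 2) id) \<in> segment_group" using ladder_id glued.par_id by metis
  qed (use assms(3) glued.par_comp in auto)
  moreover have "ladder \<pi> (\<lambda>c. twist (b + 2) \<pi> c \<noteq> (\<epsilon> \<and> c \<le> b + 2))
      = (if \<epsilon> then ladder \<pi> (twist (b + 2) \<pi>) \<circ> ?J else ladder \<pi> (twist (b + 2) \<pi>))"
    by (rule fun_eq_pt) auto
  ultimately show ?thesis using J glued.par_comp by metis
qed

text \<open>
  The product of the generators \<open>b + 1\<close> and \<open>b + 2\<close> permutes three columns beyond \<open>b\<close> cyclically and flips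
  exactly the columns \<open>0, \<dots>, b\<close>.  Its cube \<open>f\<close> is therefore the pure flip of these columns.  Dividing by \<open>f\<close>
  separates the flips from the generator \<open>b + 1\<close>, which yields all column permutations without flips.
  If \<open>s \<le> b\<close>, conjugating \<open>f\<close> by them yields the flips of pairs of columns, and hence of all even
  sets of columns from \<open>s\<close> on.
\<close>

lemma signed_ladder_in:
  assumes eb: "b + 3 \<le> e" and sb: "s \<le> Suc b" and "odd b" and \<pi>: "\<pi> permutes {s..e}"
    and F: "\<And>c. c < s \<Longrightarrow> F c = \<epsilon>" "\<And>c. e < c \<Longrightarrow> \<not> F c" "even (card {c. F c})"
    and top: "\<And>c. s = Suc b \<Longrightarrow> s \<le> c \<Longrightarrow> c \<le> e \<Longrightarrow> \<not> F c"
  shows "ladder \<pi> F \<in> segment_group"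
proof -
  let ?f = "ladder id (\<lambda>c. c \<le> b)"
  let ?x = "rung b (Suc b) \<circ> rung b (Suc (Suc b))"
  have x: "?x \<in> segment_group"
    using rung_in[of "Suc b"] rung_in[of "Suc (Suc b)"] eb sb by (intro glued.par_comp) auto
  have "?x \<circ> (?x \<circ> ?x) = ?f"
    by (rule fun_eq_pt) (auto simp: rung_pt rung_0 transpose_def)
  then have f: "?f \<in> segment_group" using x glued.par_comp by metis
  have plain: "ladder \<rho> (\<lambda>_. False) \<in> segment_group" if "\<rho> permutes {s..e}" for \<rho>
  proof (rule plain_ladder_in[OF _ that])
    fix i assume i: "s \<le> i" "i < e"
    have "ladder (transpose i (Suc i)) (\<lambda>_. False) = (if i = Suc b then ?f \<circ> rung b i else rung b i)"
      by (rule fun_eq_pt) (auto simp: rung_pt rung_0 transpose_def)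
    then show "ladder (transpose i (Suc i)) (\<lambda>_. False) \<in> segment_group"
      using f rung_in[OF i] glued.par_comp by metis
  qed
  have xor: "ladder id (\<lambda>c. D c \<noteq> E c) \<in> segment_group" if "ladder id D \<in> segment_group" "ladder id E \<in> segment_group" for D E
  proof -
    have "ladder id (\<lambda>c. D c \<noteq> E c) = ladder id D \<circ> ladder id E"
      by (rule fun_eq_pt) auto
    then show ?thesis using that glued.par_comp by metis
  qed
  define E where "E c \<longleftrightarrow> F c \<noteq> (\<epsilon> \<and> c \<le> b)" for c
  have "ladder id E \<in> segment_group"
  proof (cases "s = Suc b")
    case True
    have "\<not> E c" for c
      using F(1)[of c] F(2)[of c] top[OF True, of c] True eb unfolding E_def
      by (cases "c < s"; cases "c \<le> e") auto
    then have "E = (\<lambda>_. False)" by auto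
    then show ?thesis using ladder_id glued.par_id by metis
  next
    case False
    then have sb': "s \<le> b" using sb by simp
    \<comment> \<open>A transposition across the boundary after column \<open>b\<close> changes the set flipped by \<open>f\<close> in just two columns.\<close>
    have mixed: "ladder id (\<lambda>c. (c = y) \<noteq> (c = x)) \<in> segment_group" if "s \<le> y" "y \<le> b" "b < x" "x \<le> e" for x y
    proof -
      let ?t = "ladder (transpose y x) (\<lambda>_. False)"
      have t: "?t \<in> segment_group" by (rule plain) (use that in \<open>auto intro!: permutes_swap_id\<close>)
      have eq: "ladder id (\<lambda>c. (c = y) \<noteq> (c = x)) = ?f \<circ> (?t \<circ> (?f \<circ> ?t))"
        using that by (intro fun_eq_pt) (auto simp: transpose_def)
      show ?thesis unfolding eq by (intro glued.par_comp f t)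
    qed
    have pair: "ladder id (\<lambda>c. (c = y) \<noteq> (c = x)) \<in> segment_group" if "x \<in> {s..e}" "y \<in> {s..e}" for x y
    proof -
      have sym: "(\<lambda>c. (c = y) \<noteq> (c = x)) = (\<lambda>c. (c = x) \<noteq> (c = y))"
        and tri: "(\<lambda>c. (c = y) \<noteq> (c = x)) = (\<lambda>c. ((c = y) \<noteq> (c = z)) \<noteq> ((c = x) \<noteq> (c = z)))"
        and tri': "(\<lambda>c. (c = y) \<noteq> (c = x)) = (\<lambda>c. ((c = z) \<noteq> (c = y)) \<noteq> ((c = z) \<noteq> (c = x)))" for z
        by auto
      consider "y \<le> b" "b < x" | "x \<le> b" "b < y" | "x \<le> b" "y \<le> b" | "b < x" "b < y" by linarith
      then show ?thesis
      proof cases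
        case 1
        then show ?thesis using mixed that by simp
      next
        case 2
        then show ?thesis unfolding sym using mixed that by simp
      next
        case 3
        show ?thesis unfolding tri[of e] by (rule xor; rule mixed) (use 3 that eb in auto)
      next
        case 4
        show ?thesis unfolding tri'[of s] by (rule xor; rule mixed) (use 4 that sb' in auto)
      qed
    qed
    have evens: "ladder id (\<lambda>c. c \<in> X) \<in> segment_group" if "X \<subseteq> {s..e}" "even (card X)" for X
      using that
    proof (induction "card X" arbitrary: X rule: less_induct)
      case less
      have fin: "finite X" using less.prems(1) finite_subset by blast
      show ?case
      proof (cases "X = {}")
        case True
        then show ?thesis using ladder_id glued.par_id by simp
      next
        case False
        then obtain x where x: "x \<in> X" by blast
        have "X \<noteq> {x}" using less.prems(2) by auto
        then obtain y where y: "y \<in> X" "y \<noteq> x" using x by blast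
        have "card X = Suc (Suc (card (X - {x} - {y})))"
          using card_Suc_Diff1[OF fin x] card_Suc_Diff1[of "X - {x}" y] y fin by simp
        then have "ladder id (\<lambda>c. c \<in> X - {x} - {y}) \<in> segment_group"
          using less.hyps[of "X - {x} - {y}"] less.prems by auto
        moreover have "ladder id (\<lambda>c. (c = y) \<noteq> (c = x)) \<in> segment_group" using pair x y less.prems(1) by blast
        ultimately have "ladder id (\<lambda>c. (c \<in> X - {x} - {y}) \<noteq> ((c = y) \<noteq> (c = x))) \<in> segment_group" by (rule xor)
        moreover have "(\<lambda>c. (c \<in> X - {x} - {y}) \<noteq> ((c = y) \<noteq> (c = x))) = (\<lambda>c. c \<in> X)"
          using x y by auto
        ultimately show ?thesis by simp
      qed
    qed
    have "{c. F c} \<subseteq> {..e}" using F(2) linorder_not_less by blast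
    then have fin: "finite {c. F c}" by (rule finite_subset) simp
    have "even (card {c. \<epsilon> \<and> c \<le> b})" using \<open>odd b\<close> by (cases \<epsilon>) (auto simp flip: atMost_def)
    then have "even (card {c. E c})"
      using even_card_sym_diff[OF fin, of "{c. \<epsilon> \<and> c \<le> b}"] F(3) by (simp add: E_def)
    moreover have "{c. E c} \<subseteq> {s..e}"
    proof
      fix c assume "c \<in> {c. E c}"
      then show "c \<in> {s..e}" using F(1)[of c] F(2)[of c] sb' eb unfolding E_def
        by (cases "c < s"; cases "e < c") auto
    qed
    ultimately show ?thesis using evens[of "{c. E c}"] by simp
  qed
  moreover have "ladder id (\<lambda>c. \<epsilon> \<and> c \<le> b) \<in> segment_group"
    using f ladder_id glued.par_id by (cases \<epsilon>) auto
  ultimately have "ladder id (\<lambda>c. E c \<noteq> (\<epsilon> \<and> c \<le> b)) \<in> segment_group" by (rule xor)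
  moreover have "(\<lambda>c. E c \<noteq> (\<epsilon> \<and> c \<le> b)) = F" by (auto simp: E_def)
  ultimately have "ladder id F \<in> segment_group" by simp
  moreover have eq: "ladder \<pi> F = ladder \<pi> (\<lambda>_. False) \<circ> ladder id F" by (rule fun_eq_pt) auto
  ultimately show ?thesis unfolding eq by (intro glued.par_comp plain \<pi>)
qed

end

text \<open>
  The distinction of cases follows the description of the initial segment.  If there are no flips,
  column permutations suffice.  For \<open>e = b + 2\<close> the twisted lifts are relevant, and if moreover
  \<open>s = b + 1\<close>, the absence of a flip in column \<open>b + 1\<close> leaves only the identity and the
  single generator of the common segment.
\<close>

theorem one_sided_intersection:
  assumes b: "odd b" and br: "b + 2 \<le> r" and e: "e \<le> r" and s: "s \<le> r"
    and g: "g \<in> glued.par b r {..<e}" "g \<in> glued.par b r {s..<2 * r}"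
  shows "g \<in> glued.par b r {s..<e}"
proof -
  obtain \<epsilon> where \<epsilon>: "\<epsilon> \<Longrightarrow> s \<le> Suc b" and low: "\<And>c d. c < s \<Longrightarrow> g (pt c d) = pt c (d \<noteq> \<epsilon>)"
    and high: "\<And>c. Suc b \<le> s \<Longrightarrow> s \<le> c \<Longrightarrow> c \<le> r
      \<Longrightarrow> \<exists>c'. s \<le> c' \<and> c' \<le> r \<and> g (pt c False) = pt c' False"
    using suffix_on_left[OF s g(2)] by blast
  have ladder_facts: "\<pi> permutes {s..e}" "\<And>c. c < s \<Longrightarrow> F c = \<epsilon>"
    "\<And>c. Suc b \<le> s \<Longrightarrow> s \<le> c \<Longrightarrow> c \<le> r \<Longrightarrow> \<not> F c" if "g = ladder \<pi> F" "\<pi> permutes {..e}" for \<pi> F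
  proof -
    have lo: "\<pi> c = c \<and> F c = \<epsilon>" if "c < s" for c
      using low[OF that, of True] \<open>g = ladder \<pi> F\<close> by auto
    then show "\<pi> permutes {s..e}" using permutes_interval that(2) by blast
    show "F c = \<epsilon>" if "c < s" for c using lo that by blast
    show "\<not> F c" if "Suc b \<le> s" "s \<le> c" "c \<le> r" for c
      using high[OF that] \<open>g = ladder \<pi> F\<close> by auto
  qed
  have plain: "ladder \<pi> (\<lambda>_. False) \<in> glued.par b r {s..<e}"
    if "\<pi> permutes {s..e}" "e \<le> Suc b \<or> b + 2 \<le> s" for \<pi>
  proof (rule plain_ladder_in[OF e _ that(1)])
    fix i assume i: "s \<le> i" "i < e"
    have "ladder (transpose i (Suc i)) (\<lambda>_. False) = rung b i"
      by (rule fun_eq_pt) (use i that(2) in \<open>auto simp: rung_pt rung_0\<close>)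
    then show "ladder (transpose i (Suc i)) (\<lambda>_. False) \<in> glued.par b r {s..<e}"
      using rung_in[OF e i] by simp
  qed
  consider "e \<le> Suc b" | "b + 2 \<le> e" "b + 2 \<le> s" | "e = b + 2" "s \<le> Suc b" | "b + 3 \<le> e" "s \<le> Suc b"
    by linarith
  then show ?thesis
  proof cases
    case 1
    obtain \<pi> where \<pi>: "g = ladder \<pi> (\<lambda>_. False)" "\<pi> permutes {..e}"
      using prefix_small[OF e 1 g(1)] .
    then show ?thesis using plain ladder_facts(1) 1 by blast
  next
    case 2
    obtain \<pi> F where \<pi>: "g = ladder \<pi> F" "\<pi> permutes {..e}" and F: "\<And>c. F c \<Longrightarrow> c \<le> e"
      using prefix_large[OF b e 2(1) g(1)] by metis
    have "\<not> F c" for c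
      using ladder_facts(2,3)[OF \<pi>, of c] F[of c] \<epsilon> 2 e by (cases "c < s") auto
    then have "F = (\<lambda>_. False)" by auto
    then show ?thesis using plain ladder_facts(1) \<pi> 2 by blast
  next
    case 3
    obtain \<pi> \<delta> where \<pi>: "g = ladder \<pi> (\<lambda>c. twist (b + 2) \<pi> c \<noteq> (\<delta> \<and> c \<le> b + 2))"
      "\<pi> permutes {..b + 2}" using prefix_middle[OF br g(1)[unfolded 3]] .
    note facts = ladder_facts[OF \<pi>(1) \<pi>(2)[folded 3(1)]]
    show ?thesis
    proof (cases "s = Suc b")
      case False
      then show ?thesis unfolding \<pi>(1) using 3
        by (intro twisted_ladder_in[OF e _ _ facts(1)]) auto
    next
      case True
      have fixd: "\<pi> c = c" if "c \<noteq> Suc b" "c \<noteq> b + 2" for c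
        using permutes_not_in[OF facts(1), of c] that True 3 by auto
      have inj: "inj \<pi>" using \<pi>(2) by (rule permutes_inj)
      have im: "\<pi> (Suc b) \<in> {Suc b, b + 2}" "\<pi> (b + 2) \<in> {Suc b, b + 2}"
        using permutes_in_image[OF facts(1), of "Suc b"] permutes_in_image[OF facts(1), of "b + 2"] True 3
        by auto
      have noflip: "\<not> (twist (b + 2) \<pi> (Suc b) \<noteq> (\<delta> \<and> Suc b \<le> b + 2))"
        using facts(3)[of "Suc b"] True br by simp
      show ?thesis
      proof (cases "\<pi> (Suc b) = b + 2")
        case mv: True
        then have "\<pi> (b + 2) = Suc b" using im injD[OF inj, of "Suc b" "b + 2"] by auto
        then have t: "\<pi> = transpose (Suc b) (Suc (Suc b))" using mv fixd by (auto simp: fun_eq_iff transpose_def)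
        have "\<delta>" using noflip mv by (simp add: twist_def)
        have "g = rung b (Suc b)" unfolding \<pi>(1)
          by (rule fun_eq_pt) (auto simp: \<open>\<delta>\<close> t rung_pt rung_0 twist_def transpose_def)
        then show ?thesis using rung_in[OF e, of s "Suc b"] True 3 by simp
      next
        case mv: False
        then have "\<pi> (b + 2) = b + 2" "\<pi> (Suc b) = Suc b"
          using im injD[OF inj, of "Suc b" "b + 2"] by auto
        then have t: "\<pi> = id" using fixd by (auto simp: fun_eq_iff) (metis)
        have "\<not> \<delta>" using noflip mv by (simp add: twist_def)
        have "g = id" unfolding \<pi>(1)
          by (rule fun_eq_pt) (auto simp: \<open>\<not> \<delta>\<close> t twist_def)
        then show ?thesis using glued.par_id by simp
      qed
    qed
  next
    case 4
    then have "b + 2 \<le> e" by simp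
    then obtain \<pi> F where \<pi>: "g = ladder \<pi> F" "\<pi> permutes {..e}" and F: "\<And>c. F c \<Longrightarrow> c \<le> e"
      "even (card {c. F c})" using prefix_large[OF b e _ g(1)] by metis
    note facts = ladder_facts[OF \<pi>]
    show ?thesis unfolding \<pi>(1)
    proof (rule signed_ladder_in[OF e 4 b facts(1,2)])
      show "even (card {c. F c})" by (rule F(2))
      show "\<not> F c" if "e < c" for c using F(1)[of c] that by auto
      show "\<not> F c" if "s = Suc b" "s \<le> c" "c \<le> e" for c using facts(3)[of c] that e by simp
    qed
  qed
qed

section \<open>Parabolic subgroups meeting both sides\<close>

lemma words_permutes:
  assumes "\<And>s. s \<in> S \<Longrightarrow> s permutes X" "p \<in> words S"
  shows "p permutes X"
  using assms(2)
proof (induction rule: words.induct)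
  case (words_step s p)
  then show ?case using assms(1) permutes_compose by metis
qed (rule permutes_id)

lemma words_evenperm:
  assumes "\<And>s. s \<in> S \<Longrightarrow> permutation s \<and> evenperm s" "p \<in> words S"
  shows "permutation p \<and> evenperm p"
  using assms(2)
proof (induction rule: words.induct)
  case (words_step s p)
  then show ?case using assms(1)[of s] evenperm_comp[of s p] permutation_compose[of s p] by blast
qed (simp only: permutation_id evenperm_id conj_absorb)

text \<open>
  On a set preserved by \<open>S\<close> and fixed pointwise by \<open>T\<close>, letters from \<open>T\<close> can be deleted from a word.
\<close>

lemma words_restrict:
  assumes "\<And>s x. s \<in> S \<Longrightarrow> x \<in> Z \<Longrightarrow> s x \<in> Z" "\<And>t x. t \<in> T \<Longrightarrow> x \<in> Z \<Longrightarrow> t x = x"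
    and "g \<in> words (S \<union> T)"
  obtains a where "a \<in> words S" "\<And>x. x \<in> Z \<Longrightarrow> g x = a x \<and> a x \<in> Z"
proof -
  have "\<exists>a\<in>words S. \<forall>x\<in>Z. g x = a x \<and> a x \<in> Z"
    using assms(3)
  proof (induction rule: words.induct)
    case words_id
    show ?case by (rule bexI[OF _ words.words_id]) simp
  next
    case (words_step u g)
    then obtain a where a: "a \<in> words S" "\<forall>x\<in>Z. g x = a x \<and> a x \<in> Z" by blast
    show ?case
    proof (cases "u \<in> S")
      case True
      then have "u \<circ> a \<in> words S" using a(1) by (rule words.words_step)
      moreover have "\<forall>x\<in>Z. (u \<circ> g) x = (u \<circ> a) x \<and> (u \<circ> a) x \<in> Z"
        using a(2) assms(1)[OF True] by simp
      ultimately show ?thesis by blast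
    next
      case False
      then have "u \<in> T" using words_step by blast
      then show ?thesis using a assms(2)[of u] by (intro bexI[OF _ a(1)]) simp
    qed
  qed
  then show thesis using that by blast
qed

definition word_orbit :: "('a \<Rightarrow> 'a) set \<Rightarrow> 'a \<Rightarrow> 'a set" where
  "word_orbit S p = (\<lambda>g. g p) ` words S"

lemma word_orbit_refl: "p \<in> word_orbit S p"
  unfolding word_orbit_def using words_id[of S] by (metis id_apply image_eqI)

lemma word_orbit_step:
  assumes "s \<in> S" "x \<in> word_orbit S p"
  shows "s x \<in> word_orbit S p"
proof -
  obtain g where "g \<in> words S" "x = g p" using assms(2) unfolding word_orbit_def by blast
  then show ?thesis unfolding word_orbit_def
    using words_step[OF assms(1), of g] by (intro image_eqI[of _ _ "s \<circ> g"]) auto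
qed

lemma word_orbit_compl_step:
  assumes "s \<in> S" "s \<circ> s = id" "x \<notin> word_orbit S p"
  shows "s x \<notin> word_orbit S p"
proof
  assume "s x \<in> word_orbit S p"
  from word_orbit_step[OF assms(1) this] show False using assms(2,3) by (simp add: fun_eq_iff)
qed

lemma word_orbit_subset:
  assumes "\<And>s. s \<in> S \<Longrightarrow> s permutes X" "p \<in> X"
  shows "word_orbit S p \<subseteq> X"
proof
  fix x assume "x \<in> word_orbit S p"
  then obtain g where g: "g \<in> words S" "x = g p" unfolding word_orbit_def by blast
  have "g permutes X" using words_permutes[OF assms(1) g(1)] .
  then show "x \<in> X" using assms(2) g(2) by (simp add: permutes_in_image)
qed

lemma gen_permutes_left: "i < r \<Longrightarrow> gen b r i permutes {1..2 * r + 2}"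
  using rung_permutes by (simp add: gen_left)

lemma gen_permutes_right: "r \<le> i \<Longrightarrow> i < 2 * r \<Longrightarrow> gen b r i permutes {2 * r + 2..4 * r + 3}"
  by (rule involution_permutes[OF gen_invol], rule gen_fixes_below) auto

lemma gen_moves_centre_left:
  assumes "b + 2 \<le> r"
  shows "gen b r (r - 1) (2 * r + 2) \<noteq> 2 * r + 2"
proof -
  obtain k where r: "r = Suc k" using assms by (cases r) auto
  have p: "2 * r + 2 = pt r True" by (simp add: pt_def)
  have "gen b r (r - 1) (pt r True) = pt k (True \<noteq> (k = Suc b \<and> Suc k \<le> b))"
    by (simp add: gen_left rung_pt r)
  then show ?thesis unfolding p by (simp add: r)
qed

lemma mirror_centre: "mirror (4 * r + 3) (2 * r + 2) = 2 * r + 2"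
  by (simp add: mirror_def)

lemma gen_moves_centre_right:
  assumes "b + 2 \<le> r"
  shows "gen b r r (2 * r + 2) \<noteq> 2 * r + 2"
proof
  let ?m = "mirror (4 * r + 3)"
  assume fixd: "gen b r r (2 * r + 2) = 2 * r + 2"
  have "2 * r - 1 - r = r - 1" "r < 2 * r" using assms by auto
  then have "?m \<circ> gen b r r \<circ> ?m = gen b r (r - 1)" using mirror_gen[of r r b] by simp
  then have "gen b r (r - 1) (2 * r + 2) = ?m (gen b r r (?m (2 * r + 2)))" by (simp add: fun_eq_iff)
  then show False using fixd gen_moves_centre_left[OF assms] by (simp only: mirror_centre)
qed

text \<open>
  The parts of the orbit of the central point in the two ladders, for a segment that starts
  at \<open>s\<close> and ends before \<open>e\<close>.
\<close>

abbreviation orbL :: "nat \<Rightarrow> nat \<Rightarrow> nat \<Rightarrow> nat set" where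
  "orbL b r s \<equiv> word_orbit (gen b r ` {s..<r}) (2 * r + 2)"

abbreviation orbR :: "nat \<Rightarrow> nat \<Rightarrow> nat \<Rightarrow> nat set" where
  "orbR b r e \<equiv> word_orbit (gen b r ` {r..<e}) (2 * r + 2)"

lemma orbL_subset: "orbL b r s \<subseteq> {1..2 * r + 2}"
  by (rule word_orbit_subset) (use gen_permutes_left in auto)

lemma orbR_subset: "e \<le> 2 * r \<Longrightarrow> orbR b r e \<subseteq> {2 * r + 2..4 * r + 3}"
  by (rule word_orbit_subset) (use gen_permutes_right in auto)

text \<open>
  Any point of the left part and any point of the right part other than the centre are reached from the
  centre by a left and by a right word; the commutator of the two words is a 3-cycle on these
  three points.
\<close>

lemma alternating_on_central_orbit:
  assumes br: "b + 2 \<le> r" and s: "s < r" and e: "r < e" "e \<le> 2 * r"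
    and q: "q permutes orbL b r s \<union> orbR b r e" "evenperm q"
  shows "q \<in> glued.par b r {s..<e}"
proof -
  let ?p = "2 * r + 2"
  let ?S = "gen b r ` {s..<r}" and ?T = "gen b r ` {r..<e}"
  define A where "A = orbL b r s - {?p}"
  define B where "B = orbR b r e - {?p}"
  have union: "insert ?p (A \<union> B) = orbL b r s \<union> orbR b r e"
    unfolding A_def B_def using word_orbit_refl[of ?p] by blast
  show ?thesis
  proof (rule alternating_from_three_cycles[of _ A B ?p q])
    show "id \<in> glued.par b r {s..<e}" by (rule glued.par_id)
    show "f \<circ> g \<in> glued.par b r {s..<e}"
      if "f \<in> glued.par b r {s..<e}" "g \<in> glued.par b r {s..<e}" for f g
      using that by (rule glued.par_comp)
    show "finite A" unfolding A_def using finite_subset[OF orbL_subset] by simp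
    show "finite B" unfolding B_def using finite_subset[OF orbR_subset[OF e(2)]] by simp
    have "gen b r (r - 1) ?p \<in> orbL b r s"
      by (rule word_orbit_step[OF _ word_orbit_refl]) (use s in auto)
    then show "A \<noteq> {}" unfolding A_def using gen_moves_centre_left[OF br] by blast
    have "gen b r r ?p \<in> orbR b r e"
      by (rule word_orbit_step[OF _ word_orbit_refl]) (use e in auto)
    then show "B \<noteq> {}" unfolding B_def using gen_moves_centre_right[OF br] by blast
    show "A \<inter> B = {}"
    proof -
      have "x = ?p" if "x \<in> orbL b r s" "x \<in> orbR b r e" for x
        using that orbL_subset[of b r s] orbR_subset[OF e(2), of b] by fastforce
      then show ?thesis unfolding A_def B_def by blast
    qed
    show "?p \<notin> A" "?p \<notin> B" by (auto simp: A_def B_def)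
    show "q permutes insert ?p (A \<union> B)" unfolding union by (rule q(1))
    fix x y assume "x \<in> A" "y \<in> B"
    then obtain \<alpha> \<beta> where \<alpha>: "\<alpha> \<in> words ?S" "x = \<alpha> ?p" "x \<noteq> ?p"
      and \<beta>: "\<beta> \<in> words ?T" "y = \<beta> ?p" "y \<noteq> ?p"
      unfolding A_def B_def word_orbit_def by blast
    have \<alpha>_perm: "\<alpha> permutes {1..2 * r + 2}"
      by (rule words_permutes[OF _ \<alpha>(1)]) (use gen_permutes_left in auto)
    have \<beta>_perm: "\<beta> permutes {2 * r + 2..4 * r + 3}"
      by (rule words_permutes[OF _ \<beta>(1)]) (use gen_permutes_right e in auto)
    obtain \<alpha>' where \<alpha>': "\<alpha>' \<in> words ?S" "\<alpha>' \<circ> \<alpha> = id" "\<alpha> \<circ> \<alpha>' = id"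
      by (rule words_inverse[OF _ \<alpha>(1)]) (use gen_invol in auto)
    obtain \<beta>' where \<beta>': "\<beta>' \<in> words ?T" "\<beta>' \<circ> \<beta> = id" "\<beta> \<circ> \<beta>' = id"
      by (rule words_inverse[OF _ \<beta>(1)]) (use gen_invol in auto)
    have sub: "words ?S \<subseteq> glued.par b r {s..<e}" "words ?T \<subseteq> glued.par b r {s..<e}"
      unfolding glued.par_def by (intro words_mono image_mono; use s e in auto)+
    have "\<alpha> \<circ> \<beta> \<circ> \<alpha>' \<circ> \<beta>' \<in> glued.par b r {s..<e}"
      by (intro glued.par_comp) (use sub \<alpha>(1) \<beta>(1) \<alpha>'(1) \<beta>'(1) in blast)+
    also have "\<alpha> \<circ> \<beta> \<circ> \<alpha>' \<circ> \<beta>' = transpose ?p (\<beta> ?p) \<circ> transpose ?p (\<alpha> ?p)"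
    proof (rule commutator_three_cycle[OF \<alpha>'(3,2) \<beta>'(3,2)])
      show "\<alpha> z = z \<or> \<beta> z = z" if "z \<noteq> ?p" for z
        using that permutes_not_in[OF \<alpha>_perm, of z] permutes_not_in[OF \<beta>_perm, of z] by fastforce
    qed (use \<alpha> \<beta> in auto)
    finally show "transpose ?p y \<circ> transpose ?p x \<in> glued.par b r {s..<e}"
      by (simp only: \<alpha>(2) \<beta>(2))
  qed (rule q(2))
qed

lemma par_evenperm:
  assumes "odd b" "I \<subseteq> {..<2 * r}" "g \<in> glued.par b r I"
  shows "permutation g" "evenperm g" "g permutes {1..4 * r + 3}"
proof -
  have p: "s permutes {1..4 * r + 3}" if "s \<in> gen b r ` I" for s
    using that assms(2) gen_permutes by auto
  then have "permutation s \<and> evenperm s" if "s \<in> gen b r ` I" for s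
    using that gen_evenperm[OF assms(1)] unfolding permutation_permutes by blast
  then show "permutation g" "evenperm g"
    using words_evenperm[of "gen b r ` I" g] assms(3) unfolding glued.par_def by blast+
  show "g permutes {1..4 * r + 3}"
    using words_permutes[of "gen b r ` I" "{1..4 * r + 3}" g] p assms(3) unfolding glued.par_def by blast
qed

text \<open>
  The sets \<open>ZL\<close> and \<open>ZR\<close> of points outside the central orbit are preserved by the generators of
  the common segment on their own side and fixed by all generators of the other side.  So \<open>g\<close> acts on them like words
  \<open>\<alpha>\<close> and \<open>\<beta>\<close> in the common segment, and \<open>q\<close>, the quotient of \<open>g\<close> by both, is an even permutation of the
  central orbit.
\<close>

theorem crossing_intersection:
  assumes b: "odd b" and br: "b + 2 \<le> r" and s: "s < r" and e: "r < e" "e \<le> 2 * r"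
    and g: "g \<in> glued.par b r {..<e}" "g \<in> glued.par b r {s..<2 * r}"
  shows "g \<in> glued.par b r {s..<e}"
proof -
  let ?p = "2 * r + 2"
  let ?S = "gen b r ` {s..<r}" and ?T = "gen b r ` {r..<e}"
  define ZL where "ZL = {1..?p} - orbL b r s"
  define ZR where "ZR = {?p..4 * r + 3} - orbR b r e"
  have pL: "x < ?p" if "x \<in> ZL" for x
    using that word_orbit_refl[of ?p ?S] unfolding ZL_def by (cases "x = ?p") auto
  have pR: "?p < x" if "x \<in> ZR" for x
    using that word_orbit_refl[of ?p ?T] unfolding ZR_def by (cases "x = ?p") auto
  have SZ: "u x \<in> ZL" if "u \<in> ?S" "x \<in> ZL" for u x
    using that word_orbit_compl_step[OF that(1), of x ?p] gen_invol permutes_in_image[OF gen_permutes_left, of _ r b x]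
    unfolding ZL_def by auto
  have TZ: "u x \<in> ZR" if "u \<in> ?T" "x \<in> ZR" for u x
    using that word_orbit_compl_step[OF that(1), of x ?p] gen_invol e(2)
      permutes_in_image[OF gen_permutes_right, of r _ b x]
    unfolding ZR_def by auto
  have fixL: "u x = x" if "u \<in> gen b r ` {r..<2 * r}" "x < ?p" for u x
    using that gen_fixes_below[of r _ x b] by auto
  have fixR: "u x = x" if "u \<in> gen b r ` {..<r}" "?p < x" for u x
    using that gen_fixes_above[of _ r x b] by auto
  have "{s..<2 * r} = {s..<r} \<union> {r..<2 * r}" using s by auto
  then have gL: "g \<in> words (?S \<union> gen b r ` {r..<2 * r})"
    using g(2) unfolding glued.par_def by (metis image_Un)
  obtain \<alpha> where \<alpha>: "\<alpha> \<in> words ?S" "\<And>x. x \<in> ZL \<Longrightarrow> g x = \<alpha> x \<and> \<alpha> x \<in> ZL"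
    by (rule words_restrict[of ?S ZL "gen b r ` {r..<2 * r}" g]) (use SZ fixL pL gL in blast)+
  have "{..<e} = {r..<e} \<union> {..<r}" using e by auto
  then have gR: "g \<in> words (?T \<union> gen b r ` {..<r})"
    using g(1) unfolding glued.par_def by (metis image_Un)
  obtain \<beta> where \<beta>: "\<beta> \<in> words ?T" "\<And>x. x \<in> ZR \<Longrightarrow> g x = \<beta> x \<and> \<beta> x \<in> ZR"
    by (rule words_restrict[of ?T ZR "gen b r ` {..<r}" g]) (use TZ fixR pR gR in blast)+
  obtain \<alpha>' where \<alpha>': "\<alpha>' \<in> words ?S" "\<alpha>' \<circ> \<alpha> = id" "\<alpha> \<circ> \<alpha>' = id"
    by (rule words_inverse[OF _ \<alpha>(1)]) (use gen_invol in auto)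
  obtain \<beta>' where \<beta>': "\<beta>' \<in> words ?T" "\<beta>' \<circ> \<beta> = id" "\<beta> \<circ> \<beta>' = id"
    by (rule words_inverse[OF _ \<beta>(1)]) (use gen_invol in auto)
  have \<alpha>'_perm: "\<alpha>' permutes {1..?p}"
    by (rule words_permutes[OF _ \<alpha>'(1)]) (use gen_permutes_left in auto)
  have \<beta>'_perm: "\<beta>' permutes {?p..4 * r + 3}"
    by (rule words_permutes[OF _ \<beta>'(1)]) (use gen_permutes_right e in auto)
  define q where "q = \<beta>' \<circ> (\<alpha>' \<circ> g)"
  have sub: "words ?S \<subseteq> glued.par b r {s..<e}" "words ?T \<subseteq> glued.par b r {s..<e}"
    "glued.par b r {s..<e} \<subseteq> glued.par b r {..<2 * r}" "glued.par b r {..<e} \<subseteq> glued.par b r {..<2 * r}"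
    unfolding glued.par_def by (intro words_mono image_mono; use s e in auto)+
  have "q \<in> glued.par b r {..<2 * r}"
    unfolding q_def by (intro glued.par_comp) (use sub \<alpha>'(1) \<beta>'(1) g(1) in blast)+
  note q = par_evenperm[OF b order_refl this]
  have "q x = x" if "x \<in> {1..4 * r + 3} - (orbL b r s \<union> orbR b r e)" for x
  proof -
    consider "x \<in> ZL" | "x \<in> ZR" using \<open>x \<in> _\<close> unfolding ZL_def ZR_def by fastforce
    then show ?thesis
    proof cases
      case 1
      have "\<alpha>' (g x) = x" using \<alpha>(2)[OF 1] \<alpha>'(2) by (simp add: fun_eq_iff)
      moreover have "\<beta>' x = x" using permutes_not_in[OF \<beta>'_perm, of x] pL[OF 1] by auto
      ultimately show ?thesis by (simp add: q_def)
    next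
      case 2
      have "g x \<in> ZR" using \<beta>(2)[OF 2] by simp
      then have "\<alpha>' (g x) = g x" using permutes_not_in[OF \<alpha>'_perm, of "g x"] pR[of "g x"] by auto
      moreover have "\<beta>' (g x) = x" using \<beta>(2)[OF 2] \<beta>'(2) by (simp add: fun_eq_iff)
      ultimately show ?thesis by (simp add: q_def)
    qed
  qed
  then have "q permutes orbL b r s \<union> orbR b r e" by (rule permutes_superset[OF q(3)])
  then have q_in: "q \<in> glued.par b r {s..<e}"
    using alternating_on_central_orbit[OF br s e] q(2) by blast
  have "g = \<alpha> \<circ> (\<beta> \<circ> q)"
    using \<alpha>'(3) \<beta>'(3) by (simp add: q_def fun_eq_iff)
  also have "\<dots> \<in> glued.par b r {s..<e}"
    by (intro glued.par_comp subsetD[OF sub(1) \<alpha>(1)] subsetD[OF sub(2) \<beta>(1)] q_in)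
  finally show ?thesis .
qed

section \<open>Reversal\<close>

lemma mirror_conj_comp:
  "mirror N \<circ> (f \<circ> g) \<circ> mirror N = (mirror N \<circ> f \<circ> mirror N) \<circ> (mirror N \<circ> g \<circ> mirror N)"
  using mirror_mirror[of N] by (simp add: fun_eq_iff)

lemma par_mirror:
  assumes "I \<subseteq> {..<2 * r}" "(\<lambda>i. 2 * r - 1 - i) ` I \<subseteq> J" "g \<in> glued.par b r I"
  shows "mirror (4 * r + 3) \<circ> g \<circ> mirror (4 * r + 3) \<in> glued.par b r J"
  using assms(3) unfolding glued.par_def
proof (induction rule: words.induct)
  case words_id
  have "mirror (4 * r + 3) \<circ> id \<circ> mirror (4 * r + 3) = id" by (simp only: comp_id mirror_mirror)
  then show ?case by (simp only: words.words_id)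
next
  case (words_step u g)
  then obtain i where i: "i \<in> I" "u = gen b r i" by blast
  have "mirror (4 * r + 3) \<circ> u \<circ> mirror (4 * r + 3) \<in> gen b r ` J"
    using mirror_gen[of i r b] i assms(1,2) by auto
  then show ?case unfolding mirror_conj_comp using words_step.IH by (rule words.words_step)
qed

text \<open>
  Reversal exchanges initial and final segments, and so reduces a final segment on the right of the
  centre to an initial segment on its left.
\<close>

theorem segment_intersection:
  assumes b: "odd b" and br: "b + 2 \<le> r" and e: "e \<le> 2 * r" and s: "s \<le> 2 * r"
  shows "glued.par b r {..<e} \<inter> glued.par b r {s..<2 * r} \<subseteq> glued.par b r {s..<e}"
proof
  fix g assume "g \<in> glued.par b r {..<e} \<inter> glued.par b r {s..<2 * r}"
  then have g: "g \<in> glued.par b r {..<e}" "g \<in> glued.par b r {s..<2 * r}" by auto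
  let ?m = "mirror (4 * r + 3)"
  consider "e \<le> r" "s \<le> r" | "e \<le> r" "r < s" | "r < e" "r \<le> s" | "s < r" "r < e" by linarith
  then show "g \<in> glued.par b r {s..<e}"
  proof cases
    case 1
    then show ?thesis using one_sided_intersection[OF b br _ _ g] by blast
  next
    case 2
    then have "g \<in> glued.par b r {r..<2 * r}" using g(2) glued.par_mono[of "{s..<2 * r}" "{r..<2 * r}"] by auto
    then show ?thesis using one_sided_intersection[OF b br 2(1) order_refl g(1)] 2 by auto
  next
    case 3
    have 1: "?m \<circ> g \<circ> ?m \<in> glued.par b r {..<2 * r - s}"
      by (rule par_mirror[OF _ _ g(2)]) (use s in auto)
    have 2: "?m \<circ> g \<circ> ?m \<in> glued.par b r {2 * r - e..<2 * r}"
      by (rule par_mirror[OF _ _ g(1)]) (use e 3 in auto)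
    have "2 * r - s \<le> r" "2 * r - e \<le> r" using 3 by auto
    then have "?m \<circ> g \<circ> ?m \<in> glued.par b r {2 * r - e..<2 * r - s}"
      using 1 2 by (rule one_sided_intersection[OF b br])
    then have "?m \<circ> (?m \<circ> g \<circ> ?m) \<circ> ?m \<in> glued.par b r {s..<e}"
      by (rule par_mirror[rotated 2]) (use e s in auto)
    then show ?thesis by (simp only: conj_mirror_twice)
  next
    case 4
    then show ?thesis using crossing_intersection[OF b br _ _ e g] by blast
  qed
qed

section \<open>The alternating group\<close>

text \<open>
  The generators carry the central point along the even row down to column 0, where the generator
  \<open>b + 1\<close> changes to the odd row, and from there along the odd row up again.
\<close>

lemma orbL_full:
  assumes br: "b + 2 \<le> r"
  shows "{1..2 * r + 2} \<subseteq> orbL b r 0"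
proof -
  let ?O = "orbL b r 0"
  have st: "rung b i x \<in> ?O" if "i < r" "x \<in> ?O" for i x
  proof -
    have "rung b i \<in> gen b r ` {0..<r}" using gen_left[OF that(1), of b] that(1) by force
    from word_orbit_step[OF this that(2)] show ?thesis .
  qed
  have T: "pt c True \<in> ?O" if "c \<le> r" for c
    using that
  proof (induction rule: inc_induct)
    case base
    show ?case using word_orbit_refl[of "2 * r + 2" "gen b r ` {0..<r}"] by (simp add: pt_def)
  next
    case (step c)
    have "rung b c (pt (Suc c) True) = pt c True" by (simp add: rung_pt)
    then show ?case using st[of c "pt (Suc c) True"] step by simp
  qed
  have F: "pt c False \<in> ?O" if "c \<le> r" for c
    using that
  proof (induction c)
    case 0
    have "rung b (Suc b) (pt 0 True) = pt 0 False" by (simp add: rung_pt)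
    then show ?case using st[of "Suc b" "pt 0 True"] T[of 0] br by simp
  next
    case (Suc c)
    have "rung b c (pt c False) = pt (Suc c) False" by (simp add: rung_pt)
    then show ?case using st[of c "pt c False"] Suc by simp
  qed
  show ?thesis
  proof
    fix x assume x: "x \<in> {1..2 * r + 2}"
    obtain c d where cd: "x = pt c d" using x by (cases x rule: pt_exhaust) auto
    then have "c \<le> r" using x pt_le[of c d r] by simp
    then show "x \<in> ?O" unfolding cd using T[of c] F[of c] by (cases d) auto
  qed
qed

lemma orbR_full:
  assumes br: "b + 2 \<le> r"
  shows "{2 * r + 2..4 * r + 3} \<subseteq> orbR b r (2 * r)"
proof
  let ?m = "mirror (4 * r + 3)"
  fix x assume x: "x \<in> {2 * r + 2..4 * r + 3}"
  then have "?m x \<in> {1..2 * r + 2}" by (auto simp: mirror_def)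
  then have "?m x \<in> orbL b r 0" using orbL_full[OF br] by (rule subsetD[rotated])
  then obtain \<alpha> where \<alpha>: "\<alpha> \<in> glued.par b r {0..<r}" "?m x = \<alpha> (2 * r + 2)"
    unfolding word_orbit_def glued.par_def by blast
  have "?m \<circ> \<alpha> \<circ> ?m \<in> glued.par b r {r..<2 * r}"
    by (rule par_mirror[OF _ _ \<alpha>(1)]) auto
  moreover have "(?m \<circ> \<alpha> \<circ> ?m) (2 * r + 2) = x"
    unfolding comp_apply mirror_centre \<alpha>(2)[symmetric]
    using mirror_mirror[of "4 * r + 3"] by (simp add: fun_eq_iff)
  ultimately show "x \<in> orbR b r (2 * r)" unfolding word_orbit_def glued.par_def by blast
qed

theorem par_all_alternating:
  assumes b: "odd b" and br: "b + 2 \<le> r"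
  shows "glued.par b r {..<2 * r} = {g. g permutes {1..4 * r + 3} \<and> evenperm g}"
proof
  show "glued.par b r {..<2 * r} \<subseteq> {g. g permutes {1..4 * r + 3} \<and> evenperm g}"
    using par_evenperm[OF b order_refl] by blast
  have r: "0 < r" "r < 2 * r" using br by auto
  have "orbL b r 0 = {1..2 * r + 2}" "orbR b r (2 * r) = {2 * r + 2..4 * r + 3}"
    by (intro equalityI orbL_full[OF br] orbL_subset)
      (intro equalityI orbR_full[OF br] orbR_subset order_refl)
  then have "orbL b r 0 \<union> orbR b r (2 * r) = {1..4 * r + 3}" by auto
  then show "{g. g permutes {1..4 * r + 3} \<and> evenperm g} \<subseteq> glued.par b r {..<2 * r}"
    using alternating_on_central_orbit[OF br r order_refl] by (auto simp: atLeast0LessThan)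
qed

section \<open>The glued group\<close>

lemma generate_involutions:
  assumes "group G" "mult G = (\<circ>)" "\<one>\<^bsub>G\<^esub> = id" "S \<subseteq> carrier G" "\<And>s. s \<in> S \<Longrightarrow> s \<circ> s = id"
  shows "generate G S = words S"
proof
  have inv: "inv\<^bsub>G\<^esub> s = s" if "s \<in> S" for s
    using group.inv_equality[OF assms(1), of s s] assms(2,3,4) assms(5)[OF that] that by auto
  show "generate G S \<subseteq> words S"
  proof
    fix g assume "g \<in> generate G S"
    then show "g \<in> words S"
    proof (induction rule: generate.induct)
      case one
      show ?case unfolding assms(3) by (rule words_id)
    next
      case (incl h)
      then show ?case by (rule words_incl)
    next
      case (inv h)
      then show ?case using words_incl \<open>\<And>s. s \<in> S \<Longrightarrow> inv\<^bsub>G\<^esub> s = s\<close> by metis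
    next
      case (eng h1 h2)
      show ?case unfolding assms(2) by (rule words_comp[OF eng.IH])
    qed
  qed
  show "words S \<subseteq> generate G S"
  proof
    fix g assume "g \<in> words S"
    then show "g \<in> generate G S"
    proof (induction rule: words.induct)
      case words_id
      show ?case using generate.one[of G S] unfolding assms(3) .
    next
      case (words_step s p)
      show ?case using generate.eng[OF generate.incl[OF words_step.hyps(1)] words_step.IH]
        unfolding assms(2) .
    qed
  qed
qed

text \<open>
  The condition on \<open>t\<close> is what \<open>n \<ge> 4 * b + 11\<close> amounts to when \<open>n = 4 * (b + t) + 3\<close>.
\<close>

locale balanced_gluing =
  fixes b t r :: nat
  assumes odd_b: "odd b" and t: "2 \<le> t"
  defines "r \<equiv> b + t"
begin

abbreviation "G \<equiv> glue_group b t b t"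
abbreviation "gs \<equiv> glue_gens b t b t"

lemma br: "b + 2 \<le> r"
  using t by (simp add: r_def)

lemma gs: "gs = map (gen b r) [0..<2 * r]"
  unfolding r_def by (rule glue_gens_gen)

lemma length_gs: "length gs = 2 * r"
  by (simp add: gs)

lemma nth_gs: "i < 2 * r \<Longrightarrow> gs ! i = gen b r i"
  by (simp add: gs)

lemma image_gs: "I \<subseteq> {..<2 * r} \<Longrightarrow> (!) gs ` I = gen b r ` I"
  by (intro image_cong) (auto simp: nth_gs)

lemma set_gs: "set gs = gen b r ` {..<2 * r}"
  by (simp add: gs atLeast0LessThan)

lemma degree: "glue_degree b t b t = 4 * r + 3"
  by (simp add: glue_degree_def r_def)

lemma group_G: "group G"
  unfolding glue_group_def by (intro group.group_subgroup_generated sym_group_is_group)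

lemma mult_G: "mult G = (\<circ>)"
  by (simp only: glue_group_def mult_subgroup_generated sym_group_mult)

lemma one_G: "\<one>\<^bsub>G\<^esub> = id"
  by (simp only: glue_group_def one_subgroup_generated sym_group_one)

lemma carrier_words: "carrier G = glued.par b r {..<2 * r}"
proof -
  have sub: "set gs \<subseteq> carrier (sym_group (4 * r + 3))"
    using gen_permutes by (auto simp: set_gs sym_group_carrier)
  have "carrier G = generate (sym_group (4 * r + 3)) (set gs)"
    using sub by (simp add: glue_group_def degree carrier_subgroup_generated Int_absorb1)
  also have "\<dots> = words (set gs)"
    by (rule generate_involutions[OF sym_group_is_group sym_group_mult sym_group_one sub])
      (auto simp: set_gs gen_invol)
  finally show ?thesis by (simp add: set_gs glued.par_def)
qed

lemma carrier_alternating: "carrier G = carrier (alt_group (4 * r + 3))"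
  unfolding carrier_words par_all_alternating[OF odd_b br] alt_group_def by simp

lemma gen_carrier: "i < 2 * r \<Longrightarrow> gen b r i \<in> carrier G"
  unfolding carrier_words by (rule glued.par_gen) simp

lemma generate_G:
  assumes "I \<subseteq> {..<2 * r}"
  shows "generate G ((!) gs ` I) = glued.par b r I"
  unfolding image_gs[OF assms] glued.par_def
  by (rule generate_involutions[OF group_G mult_G one_G])
    (use assms gen_carrier gen_invol in auto)

lemma square_G: "x \<in> carrier G \<Longrightarrow> x [^]\<^bsub>G\<^esub> (2::nat) = x \<circ> x"
proof -
  interpret G: group G by (rule group_G)
  assume "x \<in> carrier G"
  then have "x [^]\<^bsub>G\<^esub> (2::nat) = x \<otimes>\<^bsub>G\<^esub> x" by (simp add: numeral_2_eq_2)
  then show ?thesis by (simp only: mult_G)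
qed

lemma sggi_G: "sggi G gs"
  unfolding sggi_def length_gs
proof (intro conjI allI impI group_G)
  show "set gs \<subseteq> carrier G" using gen_carrier by (auto simp: set_gs)
  have "set gs = (!) gs ` {..<2 * r}" by (simp only: image_gs[OF order_refl] set_gs)
  then show "generate G (set gs) = carrier G"
    by (simp only: generate_G[OF order_refl] carrier_words)
  fix i assume i: "i < 2 * r"
  show "gs ! i [^]\<^bsub>G\<^esub> (2::nat) = \<one>\<^bsub>G\<^esub>"
    by (simp only: nth_gs[OF i] square_G[OF gen_carrier[OF i]] gen_invol one_G)
  fix j assume j: "j < 2 * r" and far: "2 \<le> \<bar>int i - int j\<bar>"
  have "i + 2 \<le> j \<or> j + 2 \<le> i" using far by linarith
  then have comm: "gen b r i \<circ> gen b r j = gen b r j \<circ> gen b r i"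
    using gen_commute[of i j r b] gen_commute[of j i r b] i j by metis
  have "gen b r i \<circ> gen b r j \<in> carrier G"
    using gen_carrier[OF i] gen_carrier[OF j] unfolding carrier_words by (rule glued.par_comp)
  note sq = square_G[OF this]
  have "(gen b r i \<circ> gen b r j) \<circ> (gen b r i \<circ> gen b r j)
      = (gen b r i \<circ> gen b r j) \<circ> (gen b r j \<circ> gen b r i)"
    by (simp only: comm)
  also have "\<dots> = id"
    using gen_invol[of b r i] gen_invol[of b r j] by (simp add: fun_eq_iff)
  finally show "(gs ! i \<otimes>\<^bsub>G\<^esub> gs ! j) [^]\<^bsub>G\<^esub> (2::nat) = \<one>\<^bsub>G\<^esub>"
    unfolding nth_gs[OF i] nth_gs[OF j] mult_G sq one_G .
qed

theorem string_C_group_G: "string_C_group G gs"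
  unfolding string_C_group_def length_gs
proof (intro conjI allI impI sggi_G)
  fix I J assume IJ: "I \<subseteq> {..<2 * r}" "J \<subseteq> {..<2 * r}"
  then have "I \<inter> J \<subseteq> {..<2 * r}" by blast
  then show "generate G ((!) gs ` I) \<inter> generate G ((!) gs ` J) = generate G ((!) gs ` (I \<inter> J))"
    unfolding generate_G[OF IJ(1)] generate_G[OF IJ(2)] generate_G[OF \<open>I \<inter> J \<subseteq> _\<close>]
    by (intro glued.intersection_property segment_intersection odd_b br IJ)
qed

theorem self_dual_G: "self_dual G gs"
proof -
  let ?m = "mirror (4 * r + 3)"
  let ?f = "\<lambda>g. ?m \<circ> g \<circ> ?m"
  have closed: "?f g \<in> carrier G" if "g \<in> carrier G" for g
    using that unfolding carrier_words by (rule par_mirror[rotated 2]) (use br in auto)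
  have iso: "?f \<in> iso G G"
  proof (rule isoI)
    show "?f \<in> hom G G" by (rule homI) (simp_all only: closed mult_G mirror_conj_comp)
    show "bij_betw ?f (carrier G) (carrier G)"
      by (rule bij_betw_byWitness[where f' = ?f]) (use closed conj_mirror_twice in auto)
  qed
  have rev: "?f (gs ! i) = gs ! (length gs - 1 - i)" if "i < length gs" for i
  proof -
    have i: "i < 2 * r" "2 * r - 1 - i < 2 * r" using that by (auto simp: length_gs)
    show ?thesis unfolding length_gs nth_gs[OF i(1)] nth_gs[OF i(2)] by (rule mirror_gen[OF i(1)])
  qed
  show ?thesis unfolding self_dual_def by (rule bexI[OF _ iso]) (intro allI impI rev)
qed

theorem iso_alternating: "G \<cong> alt_group (4 * r + 3)"
proof -
  have "id \<in> iso G (alt_group (4 * r + 3))"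
    by (rule isoI, rule homI)
      (simp_all only: carrier_alternating id_apply mult_G alt_group_mult bij_betw_id)
  then show ?thesis unfolding is_iso_def by blast
qed

end

theorem corollary5p6:
  fixes b n t :: nat
  assumes "b \<ge> 1" and "odd b"
    and "n mod 4 = 3" and "n \<ge> 4 * b + 11"
    and "t = (n - 4 * b - 3) div 4"
  shows "string_C_group (glue_group b t b t) (glue_gens b t b t)
    \<and> self_dual (glue_group b t b t) (glue_gens b t b t)
    \<and> length (glue_gens b t b t) = (n - 3) div 2
    \<and> glue_group b t b t \<cong> alt_group n"
proof -
  have n: "n = 4 * (b + t) + 3" and t: "2 \<le> t" using assms(3-5) by presburger+
  interpret balanced_gluing b t "b + t" by unfold_locales (use assms(2) t in auto)
  have "(n - 3) div 2 = 2 * (b + t)" using n by simp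
  then show ?thesis
    using string_C_group_G self_dual_G length_gs iso_alternating n by simp
qed

end
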